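(* Let $m,n\ge 1$, let $f_1,\dots,f_m:\mathbb{R}^n\to\mathbb{R}$, and let $\mathcal{G}(\mathcal{V},\mathcal{E})$ be an undirected graph with $\mathcal{V}=\{1,\dots,m\}$. Suppose: (1) each $f_i$ is differentiable and there is a constant $L_{f_i}$ with $\|\nabla f_i(\mathbf{x})-\nabla f_i(\mathbf{y})\|\le L_{f_i}\|\mathbf{x}-\mathbf{y}\|$ for all $\mathbf{x},\mathbf{y}\in\mathbb{R}^n$; (2) each $f_i$ is coercive (its sublevel sets are compact) and proper (not everywhere infinite); (3) $\mathcal{G}$ is connected; (4) $\mathbf{W},\mathbf{V}\in\mathbb{R}^{m\times m}$ satisfy: $\mathbf{W}_{ij}=0$ whenever $i\ne j$ and $(i,j)\notin\mathcal{E}$; $\mathbf{W}=\mathbf{W}^\top$; $-\mathbf{I}_m\prec\mathbf{W}\preceq\mathbf{I}_m$ and $\mathrm{null}\{\mathbf{I}_m-\mathbf{W}\}=\mathrm{span}\{\mathbf{1}_m\}$; and $\mathbf{V}=\theta\mathbf{I}_m+(1-\theta)\mathbf{W}\succ 0$ for some $\theta\in(0,\tfrac12]$. Let $L_F=\max_i L_{f_i}$ and let the step-size $\alpha$ be fixed with $$0<\alpha<\frac{1-(\lambda_1(\mathbf{P}))^2}{6(L_F)^4+6(L_F)^3+48L_F+1}.$$ Then the sequence $\{\hat{\mathbf{x}}^k\}$ generated by the EXTRA iteration with step-size $\alpha$ satisfies, as $k\to\infty$, $$\frac1k\sum_{\kappa=0}^{k-1}\Big\|\big(\mathbf{I}_{mn}-\tfrac1m(\mathbf{1}_m\mathbf{1}_m^\top)\otimes\mathbf{I}_n\big)\hat{\mathbf{x}}^\kappa\Big\|^2=\mathcal{O}\Big(\frac1k\Big),\qquad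 \frac1k\sum_{\kappa=0}^{k-1}\Big\|\tfrac1m(\mathbf{1}_m\mathbf{1}_m^\top)\otimes\mathbf{I}_n\cdot\nabla F(\hat{\mathbf{x}}^\kappa)\Big\|^2=\mathcal{O}\Big(\frac1k\Big).$$
   Context: Notation: $\mathbf{I}_n$ is the identity matrix, $\mathbf{1}_m$ the all-ones vector in $\mathbb{R}^m$, $\otimes$ the Kronecker product. For $\hat{\mathbf{x}}=[\hat{\mathbf{x}}_1^\top,\dots,\hat{\mathbf{x}}_m^\top]^\top\in(\mathbb{R}^n)^m$ put $F(\hat{\mathbf{x}})=\sum_{i=1}^m f_i(\hat{\mathbf{x}}_i)$, so that $\nabla F(\hat{\mathbf{x}})=[\nabla f_1(\hat{\mathbf{x}}_1)^\top,\dots,\nabla f_m(\hat{\mathbf{x}}_m)^\top]^\top$. EXTRA: given an initial point $\hat{\mathbf{x}}^0\in(\mathbb{R}^n)^m$ and step-size $\alpha>0$, with $\hat{\mathbf{W}}=\mathbf{W}\otimes\mathbf{I}_n$ and $\hat{\mathbf{V}}=\mathbf{V}\otimes\mathbf{I}_n$, $$\hat{\mathbf{x}}^1=\hat{\mathbf{W}}\hat{\mathbf{x}}^0-\alpha\nabla F(\hat{\mathbf{x}}^0),\qquad \hat{\mathbf{x}}^{k+2}=\hat{\mathbf{x}}^{k+1}+\hat{\mathbf{W}}\hat{\mathbf{x}}^{k+1}-\hat{\mathbf{V}}\hat{\mathbf{x}}^k-\alpha[\nabla F(\hat{\mathbf{x}}^{k+1})-\nabla F(\hat{\mathbf{x}}^k)],\quad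 k\ge 0.$$ The matrix $\mathbf{P}\in\mathbb{R}^{2m\times 2m}$ is $$\mathbf{P}=\begin{bmatrix}\mathbf{W}-\frac1m\mathbf{1}_m\mathbf{1}_m^\top & \mathbf{I}_m\\ \mathbf{W}-\mathbf{V} & \mathbf{I}_m-\frac1m\mathbf{1}_m\mathbf{1}_m^\top\end{bmatrix},$$ and for a square matrix $\mathbf{C}$, $\lambda_1(\mathbf{C})\ge 0$ denotes the largest magnitude of an eigenvalue of $\mathbf{C}$ (the spectral radius). In $\mathcal{O}(1/k)$ the implied constant is independent of $k$ (it may depend on the problem data, $\alpha$ and $\hat{\mathbf{x}}^0$). *)

theory Defs
  imports
    "HOL-Analysis.Analysis"
    "HOL-Library.Landau_Symbols"
    "Graph_Theory.Digraph_Component"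
begin

text \<open>
  The type \<open>'m\<close> indexes the agents. A stacked vector in (R^n)^m is an element of
  \<open>real ^ ('m \<times> 'n)\<close>: the pair \<open>(i, k)\<close> is the position of the k-th coordinate of the
  i-th block, which is the row/column order of a Kronecker product.
\<close>

definition grad :: "('a::real_inner \<Rightarrow> real) \<Rightarrow> 'a \<Rightarrow> 'a" where
  "grad f x = (THE D. GDERIV f x :> D)"

definition coercive :: "('a::topological_space \<Rightarrow> real) \<Rightarrow> bool" where
  "coercive f \<longleftrightarrow> (\<forall>c. compact {x. f x \<le> c})"

text \<open>Properness concerns extended-real-valued functions; it holds automatically for
  functions with values in \<open>\<real>\<close>.\<close>

definition proper_fun :: "('a \<Rightarrow> ereal) \<Rightarrow> bool" where
  "proper_fun f \<longleftrightarrow> (\<exists>x. \<bar>f x\<bar> \<noteq> \<infinity>)"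

definition psd :: "real ^ 'm::finite ^ 'm \<Rightarrow> bool" where
  "psd A \<longleftrightarrow> transpose A = A \<and> (\<forall>v. 0 \<le> v \<bullet> (A *v v))"

definition pos_def :: "real ^ 'm ^ 'm \<Rightarrow> bool" where
  "pos_def A \<longleftrightarrow> transpose A = A \<and> (\<forall>v. v \<noteq> 0 \<longrightarrow> 0 < v \<bullet> (A *v v))"

definition loewner_le :: "real ^ 'm ^ 'm \<Rightarrow> real ^ 'm ^ 'm \<Rightarrow> bool"  (infix \<open>\<preceq>\<^sub>L\<close> 50) where
  "A \<preceq>\<^sub>L B \<longleftrightarrow> psd (B - A)"

definition loewner_less :: "real ^ 'm ^ 'm \<Rightarrow> real ^ 'm ^ 'm \<Rightarrow> bool"  (infix \<open>\<prec>\<^sub>L\<close> 50) where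
  "A \<prec>\<^sub>L B \<longleftrightarrow> pos_def (B - A)"

definition null_space :: "real ^ 'n ^ 'm \<Rightarrow> (real ^ 'n) set" where
  "null_space A = {v. A *v v = 0}"

definition kronecker :: "real ^ 'b ^ 'a \<Rightarrow> real ^ 'd ^ 'c \<Rightarrow> real ^ ('b::finite \<times> 'd::finite) ^ ('a::finite \<times> 'c::finite)"
    (infixl \<open>\<otimes>\<^sub>K\<close> 70) where
  "A \<otimes>\<^sub>K B = (\<chi> p q. A $ fst p $ fst q * B $ snd p $ snd q)"

definition block_mat ::
  "real ^ 'c ^ 'a \<Rightarrow> real ^ 'd ^ 'a \<Rightarrow> real ^ 'c ^ 'b \<Rightarrow> real ^ 'd ^ 'b \<Rightarrow> real ^ ('c::finite + 'd::finite) ^ ('a::finite + 'b::finite)"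
where
  "block_mat A B C D = (\<chi> p q.
     case p of
       Inl i \<Rightarrow> (case q of Inl j \<Rightarrow> A $ i $ j | Inr j \<Rightarrow> B $ i $ j)
     | Inr i \<Rightarrow> (case q of Inl j \<Rightarrow> C $ i $ j | Inr j \<Rightarrow> D $ i $ j))"

text \<open>The spectrum of a real matrix consists of its complex eigenvalues.\<close>

definition spectrum :: "real ^ 'n ^ 'n \<Rightarrow> complex set" where
  "spectrum A = {\<mu>. \<exists>v :: complex ^ 'n. v \<noteq> 0 \<and> map_matrix of_real A *v v = \<mu> *s v}"

definition spectral_radius :: "real ^ 'n ^ 'n \<Rightarrow> real" where
  "spectral_radius A = Max (cmod ` spectrum A)"

definition ones :: "real ^ 'm" where
  "ones = (\<chi> i. 1)"

definition avg_mat :: "real ^ 'm ^ 'm" where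
  "avg_mat = (1 / real CARD('m)) *\<^sub>R (\<chi> i j. ones $ i * ones $ j)"

definition P_mat :: "real ^ 'm ^ 'm \<Rightarrow> real ^ 'm ^ 'm \<Rightarrow> real ^ ('m::finite + 'm) ^ ('m + 'm)" where
  "P_mat W V = block_mat (W - avg_mat) (mat 1) (W - V) (mat 1 - avg_mat)"

definition block :: "real ^ ('m::finite \<times> 'n::finite) \<Rightarrow> 'm \<Rightarrow> real ^ 'n" where
  "block x i = (\<chi> k. x $ (i, k))"

definition F_sum :: "('m::finite \<Rightarrow> real ^ 'n::finite \<Rightarrow> real) \<Rightarrow> real ^ ('m \<times> 'n) \<Rightarrow> real" where
  "F_sum f x = (\<Sum>i\<in>UNIV. f i (block x i))"

fun extra ::
  "('m::finite \<Rightarrow> real ^ 'n::finite \<Rightarrow> real) \<Rightarrow> real ^ 'm ^ 'm \<Rightarrow> real ^ 'm ^ 'm \<Rightarrow> real \<Rightarrow>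
   real ^ ('m \<times> 'n) \<Rightarrow> nat \<Rightarrow> real ^ ('m \<times> 'n)"
where
  "extra f W V \<alpha> x0 0 = x0"
| "extra f W V \<alpha> x0 (Suc 0) = (W \<otimes>\<^sub>K mat 1) *v x0 - \<alpha> *\<^sub>R grad (F_sum f) x0"
| "extra f W V \<alpha> x0 (Suc (Suc k)) =
     extra f W V \<alpha> x0 (Suc k) + (W \<otimes>\<^sub>K mat 1) *v extra f W V \<alpha> x0 (Suc k)
     - (V \<otimes>\<^sub>K mat 1) *v extra f W V \<alpha> x0 k
     - \<alpha> *\<^sub>R (grad (F_sum f) (extra f W V \<alpha> x0 (Suc k)) - grad (F_sum f) (extra f W V \<alpha> x0 k))"

end

theory Submission
  imports Defs
begin

text \<open>
  Diagonalise \<open>W \<otimes>\<^sub>K mat 1\<close>. Along an eigenvector of eigenvalue \<open>w \<noteq> 1\<close> the iterates satisfy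
  \<open>\<xi> (k + 2) = (1 + w) * \<xi> (k + 1) - v * \<xi> k - u k\<close> with \<open>v = \<theta> + (1 - \<theta>) * w\<close>, where \<open>u\<close> is the
  corresponding component of \<open>\<alpha>\<close> times the gradient increment, and both characteristic roots
  are eigenvalues of \<open>P_mat W V\<close>. Factoring the recurrence into two first-order filters bounds
  the \<open>\<ell>\<^sup>2\<close> gain from \<open>u\<close> to \<open>\<xi>\<close> by \<open>(1 - \<rho>)\<^sup>-\<^sup>2\<close> and the gain from \<open>u\<close> to the increments of
  \<open>\<xi>\<close> by a multiple of \<open>(1 - \<rho>)\<^sup>-\<^sup>1\<close>, \<open>\<rho>\<close> being the spectral radius. Since
  \<open>48 * \<alpha> * L < 1 - \<rho>\<^sup>2\<close>, a small-gain argument bounds the disagreement energy by a small multiple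
  of the energy of the averaged gradients; the descent lemma for the mean iterate, together with
  the lower bound given by coercivity, then makes both energies finite.
\<close>

section \<open>Spectra of matrices and self-adjoint maps\<close>

text \<open>A maximiser \<open>e\<close> of the Rayleigh quotient on the unit sphere of
  \<open>S\<close> is an eigenvector: the residual \<open>d\<close> stays in \<open>S\<close>, and
  first-order optimality in that direction forces it to vanish.\<close>

lemma selfadjoint_eigenvector_exists:
  fixes f :: "'a::euclidean_space \<Rightarrow> 'a"
  assumes lin: "linear f" and sa: "\<And>x y. f x \<bullet> y = x \<bullet> f y"
    and S: "subspace S" "S \<noteq> {0}" and inv: "\<And>x. x \<in> S \<Longrightarrow> f x \<in> S"
  obtains e c where "e \<in> S" "norm e = 1" "f e = c *\<^sub>R e"
proof -
  interpret linear f by fact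
  let ?K = "S \<inter> sphere 0 1"
  have scaleS: "x \<in> S \<Longrightarrow> r *\<^sub>R x \<in> S" for x r
    using S(1) by (simp add: subspace_scale)
  obtain z where z: "z \<in> S" "z \<noteq> 0"
    using S subspace_0 by blast
  have "z /\<^sub>R norm z \<in> ?K"
    using z scaleS by simp
  moreover have "compact ?K"
    by (intro closed_Int_compact closed_subspace S(1) compact_sphere)
  moreover have "continuous_on ?K (\<lambda>x. x \<bullet> f x)"
    using lin by (intro continuous_on_inner continuous_on_id linear_continuous_on)
      (simp add: linear_conv_bounded_linear)
  ultimately obtain e where e: "e \<in> ?K" and max: "\<And>x. x \<in> ?K \<Longrightarrow> x \<bullet> f x \<le> e \<bullet> f e"
    using continuous_attains_sup[of ?K "\<lambda>x. x \<bullet> f x"] by blast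
  define c where "c = e \<bullet> f e"
  have ray: "x \<bullet> f x \<le> c * (x \<bullet> x)" if "x \<in> S" for x
  proof (cases "x = 0")
    case False
    let ?y = "x /\<^sub>R norm x"
    have "?y \<in> ?K"
      using False that scaleS by simp
    then have "?y \<bullet> f ?y \<le> c"
      unfolding c_def by (rule max)
    moreover have "?y \<bullet> f ?y = (x \<bullet> f x) / (norm x)\<^sup>2"
      by (simp add: scale power2_eq_square divide_inverse)
    ultimately show ?thesis
      using False by (simp add: divide_le_eq dot_square_norm)
  qed (simp add: zero)
  define d where "d = c *\<^sub>R e - f e"
  have eS: "e \<in> S" and ee: "e \<bullet> e = 1"
    using e by (auto simp: dot_square_norm)
  have dS: "d \<in> S"
    unfolding d_def using eS S(1) inv by (simp add: subspace_diff subspace_scale)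
  define q where "q = c * (d \<bullet> d) - d \<bullet> f d"
  text \<open>The form \<open>c * (x \<bullet> x) - x \<bullet> f x\<close> is nonnegative on \<open>S\<close> and vanishes at
    \<open>e\<close>, so its derivative at \<open>e\<close> in the direction \<open>d\<close> vanishes.\<close>
  have *: "0 \<le> 2 * t * (d \<bullet> d) + t\<^sup>2 * q" for t
  proof -
    let ?x = "e + t *\<^sub>R d"
    have "?x \<in> S"
      using eS dS S(1) by (simp add: subspace_add subspace_scale)
    then have "0 \<le> c * (?x \<bullet> ?x) - ?x \<bullet> f ?x"
      using ray by simp
    also have "\<dots> = (c * (e \<bullet> e) - e \<bullet> f e) + 2 * t * ((c *\<^sub>R e - f e) \<bullet> d) + t\<^sup>2 * q"
      by (simp add: add scale inner_add_left inner_add_right inner_diff_left q_def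
          power2_eq_square algebra_simps inner_commute[of d e] inner_commute[of d "f e"] sa)
    also have "\<dots> = 2 * t * (d \<bullet> d) + t\<^sup>2 * q"
      using ee by (simp add: c_def d_def)
    finally show ?thesis .
  qed
  have "d \<bullet> d = 0"
  proof (rule ccontr)
    assume "d \<bullet> d \<noteq> 0"
    then have D: "0 < d \<bullet> d" by simp
    \<comment> \<open>This choice keeps \<open>t * q\<close> at or above
      \<open>- (d \<bullet> d)\<close>, so the linear term wins over the quadratic one.\<close>
    define t where "t = - (d \<bullet> d) / (\<bar>q\<bar> + 1)"
    have t: "t < 0" and tq: "t * (\<bar>q\<bar> + 1) = - (d \<bullet> d)"
      using D by (auto simp: t_def divide_neg_pos)
    have "- t * q \<le> - t * (\<bar>q\<bar> + 1)"
      using t by (intro mult_left_mono) auto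
    then have "0 < 2 * (d \<bullet> d) + t * q"
      using tq D by linarith
    then have "t * (2 * (d \<bullet> d) + t * q) < 0"
      using t by (simp add: mult_neg_pos)
    then show False
      using *[of t] by (simp add: power2_eq_square algebra_simps)
  qed
  then have "f e = c *\<^sub>R e"
    by (simp add: d_def)
  then show thesis
    using that e by auto
qed

text \<open>A largest orthonormal family of eigenvectors spans: by self-adjointness its orthogonal
  complement is invariant, so a nonzero complement would contribute one more eigenvector.\<close>

lemma selfadjoint_orthonormal_eigenbasis:
  fixes f :: "'a::euclidean_space \<Rightarrow> 'a"
  assumes lin: "linear f" and sa: "\<And>x y. f x \<bullet> y = x \<bullet> f y"
  obtains B where "finite B" "pairwise orthogonal B" "\<And>b. b \<in> B \<Longrightarrow> norm b = 1"
    "span B = UNIV" "\<And>b. b \<in> B \<Longrightarrow> \<exists>c. f b = c *\<^sub>R b"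
proof -
  define P where "P B \<longleftrightarrow> finite B \<and> pairwise orthogonal B \<and>
    (\<forall>b\<in>B. norm b = 1 \<and> (\<exists>c. f b = c *\<^sub>R b))" for B :: "'a set"
  have ind: "independent B" if "P B" for B
    using that pairwise_orthogonal_independent[of B] unfolding P_def
    by (metis norm_zero zero_neq_one)
  have "P {}" by (auto simp: P_def)
  moreover have "\<forall>B. P B \<longrightarrow> card B < Suc (DIM('a))"
    using ind independent_bound by (fastforce simp: less_Suc_eq_le)
  ultimately obtain B where B: "P B" and max: "\<And>B'. P B' \<Longrightarrow> card B' \<le> card B"
    using ex_has_greatest_nat[of P "{}" card] by blast
  define S where "S = {x. \<forall>b\<in>B. b \<bullet> x = 0}"
  have S: "subspace S"
    by (auto simp: S_def subspace_def inner_add_right)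
  have inv: "f x \<in> S" if "x \<in> S" for x
  proof -
    have "b \<bullet> f x = 0" if "b \<in> B" for b
    proof -
      obtain c where "f b = c *\<^sub>R b"
        using B \<open>b \<in> B\<close> by (auto simp: P_def)
      then show ?thesis
        using \<open>x \<in> S\<close> \<open>b \<in> B\<close> sa[of b x] by (simp add: S_def)
    qed
    then show ?thesis by (simp add: S_def)
  qed
  have "S = {0}"
  proof (rule ccontr)
    assume "S \<noteq> {0}"
    then obtain e c where e: "e \<in> S" "norm e = 1" "f e = c *\<^sub>R e"
      using selfadjoint_eigenvector_exists[OF lin sa S _ inv] by blast
    have "e \<notin> B"
      using e by (auto simp: S_def dot_square_norm)
    have "P (insert e B)"
      using B e by (auto simp: P_def S_def pairwise_insert orthogonal_def inner_commute)
    then have "card (insert e B) \<le> card B"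
      by (rule max)
    then show False
      using \<open>e \<notin> B\<close> B by (simp add: P_def)
  qed
  have "span B = UNIV"
  proof (rule ccontr)
    assume "span B \<noteq> UNIV"
    then obtain x where "x \<noteq> 0" "\<And>y. y \<in> span B \<Longrightarrow> orthogonal x y"
      using orthogonal_to_subspace_exists_gen[of B UNIV] by (metis psubsetI span_UNIV top_greatest UNIV_I)
    then have "x \<in> S"
      by (auto simp: S_def orthogonal_def inner_commute span_base)
    then show False
      using \<open>S = {0}\<close> \<open>x \<noteq> 0\<close> by simp
  qed
  then show thesis
    using B that[of B] unfolding P_def by blast
qed

text \<open>Parseval's identity, later used to split the energy of a vector sequence into scalar
  energies along eigenvectors.\<close>

lemma norm_power2_orthonormal_basis:
  fixes x :: "'a::euclidean_space"
  assumes "finite B" "pairwise orthogonal B" "\<And>b. b \<in> B \<Longrightarrow> norm b = 1" "span B = UNIV"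
  shows "(norm x)\<^sup>2 = (\<Sum>b\<in>B. (b \<bullet> x)\<^sup>2)"
proof -
  have "(norm x)\<^sup>2 = x \<bullet> (\<Sum>b\<in>B. (x \<bullet> b) *\<^sub>R b)"
    using assms by (subst orthonormal_basis_expand) (auto simp: dot_square_norm)
  then show ?thesis
    by (simp add: inner_sum_right power2_eq_square inner_commute)
qed

text \<open>Finiteness is what makes the \<open>Max\<close> in the spectral radius an upper bound.
  The spectrum is the root set of the characteristic polynomial, which is nonzero because some
  number is not an eigenvalue.\<close>

lemma finite_spectrum:
  fixes A :: "real ^ 'n ^ 'n"
  shows "finite (spectrum A)"
proof -
  define M where "M = (map_matrix of_real A :: complex ^ 'n ^ 'n)"
  \<comment> \<open>The Leibniz formula for \<open>det (M - mat \<mu>)\<close>, with linear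
    polynomials as entries.\<close>
  define p where "p = (\<Sum>\<pi> | \<pi> permutes (UNIV :: 'n set).
    smult (of_int (sign \<pi>)) (\<Prod>i\<in>UNIV. [:M $ i $ \<pi> i, - (if i = \<pi> i then 1 else 0):]))"
  have p: "poly p \<mu> = det (M - mat \<mu>)" for \<mu>
    by (simp add: p_def det_def poly_sum poly_prod mat_def if_distrib if_distribR cong: if_cong)
  have char: "\<mu> \<in> spectrum A \<longleftrightarrow> poly p \<mu> = 0" for \<mu>
  proof -
    have "mat \<mu> *v v = \<mu> *s v" for v :: "complex ^ 'n"
      by (simp add: vec_eq_iff mat_def matrix_vector_mult_def if_distrib if_distribR cong: if_cong)
    then have "\<mu> \<in> spectrum A \<longleftrightarrow> (\<exists>v. v \<noteq> 0 \<and> (M - mat \<mu>) *v v = 0)"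
      by (simp add: spectrum_def M_def matrix_vector_mult_diff_rdistrib)
    also have "\<dots> \<longleftrightarrow> \<not> invertible (M - mat \<mu>)"
      by (auto simp: invertible_left_inverse matrix_left_invertible_ker)
    finally show ?thesis
      by (simp add: p invertible_det_nz)
  qed
  \<comment> \<open>\<open>R\<close> exceeds every absolute row sum, so the row in which an
    eigenvector has its largest entry refutes \<open>R\<close> as an eigenvalue.\<close>
  define R where "R = (\<Sum>i\<in>UNIV. \<Sum>j\<in>UNIV. cmod (M $ i $ j)) + 1"
  have "of_real R \<notin> spectrum A"
  proof
    assume "of_real R \<in> spectrum A"
    then obtain v where v: "v \<noteq> 0" "M *v v = of_real R *s v"
      by (auto simp: spectrum_def M_def)
    obtain i where i: "\<And>j. cmod (v $ j) \<le> cmod (v $ i)"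
      using finite_range_imageI[of "\<lambda>j. cmod (v $ j)"] Max_ge Max_in
      by (metis (mono_tags, lifting) UNIV_not_empty finite finite_imageI image_is_empty imageE rangeI)
    have "0 < cmod (v $ i)"
    proof (rule ccontr)
      assume "\<not> 0 < cmod (v $ i)"
      then have "v $ j = 0" for j
        using i[of j] by simp
      then show False
        using v(1) by (simp add: vec_eq_iff)
    qed
    have R: "(\<Sum>j\<in>UNIV. cmod (M $ i $ j)) < R"
      using member_le_sum[of i UNIV "\<lambda>i. \<Sum>j\<in>UNIV. cmod (M $ i $ j)"]
      by (simp add: R_def sum_nonneg)
    have "0 < R"
      by (simp add: R_def add_nonneg_pos sum_nonneg)
    have "R * cmod (v $ i) = cmod ((M *v v) $ i)"
      using v(2) \<open>0 < R\<close> by (simp add: norm_mult)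
    also have "\<dots> \<le> (\<Sum>j\<in>UNIV. cmod (M $ i $ j) * cmod (v $ i))"
      unfolding matrix_vector_mult_def vec_lambda_beta
      by (rule sum_norm_le) (simp add: norm_mult i mult_left_mono)
    also have "\<dots> < R * cmod (v $ i)"
      unfolding sum_distrib_right[symmetric] using R \<open>0 < cmod (v $ i)\<close>
      by (rule mult_strict_right_mono)
    finally show False by simp
  qed
  then have "p \<noteq> 0"
    unfolding char by force
  moreover have "spectrum A = {\<mu>. poly p \<mu> = 0}"
    by (intro set_eqI) (simp only: char mem_Collect_eq)
  ultimately show ?thesis
    by (simp only: poly_roots_finite not_False_eq_True)
qed

lemma cmod_le_spectral_radius:
  "\<mu> \<in> spectrum A \<Longrightarrow> cmod \<mu> \<le> spectral_radius A"
  unfolding spectral_radius_def by (intro Max_ge finite_imageI finite_spectrum imageI)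

section \<open>Energy of perturbed second-order recurrences\<close>

text \<open>The constant absorbs initial values while the coefficients of \<open>T\<close> stay
  exact, as a small-gain argument requires. A bound by the zero sequence means boundedness above,
  uniformly in \<open>N\<close>.\<close>

definition le_upto_const :: "(nat \<Rightarrow> real) \<Rightarrow> (nat \<Rightarrow> real) \<Rightarrow> bool" (infix \<open>\<lesssim>\<^sub>c\<close> 50) where
  "S \<lesssim>\<^sub>c T \<longleftrightarrow> (\<exists>C. \<forall>N. S N \<le> C + T N)"

text \<open>The squared l2 norm is truncated at \<open>N\<close>, since summability is known only at
  the very end.\<close>

definition energy :: "(nat \<Rightarrow> 'a::real_normed_vector) \<Rightarrow> nat \<Rightarrow> real" where
  "energy a N = (\<Sum>k<N. (norm (a k))\<^sup>2)"

section \<open>Calculus of bounds up to an additive constant\<close>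

lemma le_upto_constI: "(\<And>N. S N \<le> C + T N) \<Longrightarrow> S \<lesssim>\<^sub>c T"
  unfolding le_upto_const_def by blast

lemma le_upto_const_mono: "(\<And>N. S N \<le> T N) \<Longrightarrow> S \<lesssim>\<^sub>c T"
  by (rule le_upto_constI[where C = 0]) simp

lemma le_upto_const_trans [trans]:
  assumes "S \<lesssim>\<^sub>c T" "T \<lesssim>\<^sub>c U"
  shows "S \<lesssim>\<^sub>c U"
proof -
  obtain C D where "\<And>N. S N \<le> C + T N" "\<And>N. T N \<le> D + U N"
    using assms unfolding le_upto_const_def by blast
  then show ?thesis
    by (intro le_upto_constI[where C = "C + D"]) (smt (verit))
qed

lemma le_upto_const_add:
  assumes "S \<lesssim>\<^sub>c T" "S' \<lesssim>\<^sub>c T'"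
  shows "(\<lambda>N. S N + S' N) \<lesssim>\<^sub>c (\<lambda>N. T N + T' N)"
proof -
  obtain C D where "\<And>N. S N \<le> C + T N" "\<And>N. S' N \<le> D + T' N"
    using assms unfolding le_upto_const_def by blast
  then show ?thesis
    by (intro le_upto_constI[where C = "C + D"]) (smt (verit))
qed

lemma le_upto_const_cmult:
  assumes "0 \<le> c" "S \<lesssim>\<^sub>c T"
  shows "(\<lambda>N. c * S N) \<lesssim>\<^sub>c (\<lambda>N. c * T N)"
proof -
  obtain C where C: "\<And>N. S N \<le> C + T N"
    using assms unfolding le_upto_const_def by blast
  have "c * S N \<le> c * C + c * T N" for N
    using mult_left_mono[OF C \<open>0 \<le> c\<close>] by (simp add: distrib_left)
  then show ?thesis
    by (rule le_upto_constI)
qed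

lemma le_upto_const_sum:
  assumes "finite I" "\<And>i. i \<in> I \<Longrightarrow> S i \<lesssim>\<^sub>c T i"
  shows "(\<lambda>N. \<Sum>i\<in>I. S i N) \<lesssim>\<^sub>c (\<lambda>N. \<Sum>i\<in>I. T i N)"
  using assms
proof (induction I rule: finite_induct)
  case empty
  show ?case by (rule le_upto_const_mono) simp
next
  case (insert i I)
  then show ?case
    using le_upto_const_add[of "S i" "T i"] by simp
qed

text \<open>This closes a feedback loop of gain \<open>c\<close>: truncated energies are real
  numbers, so \<open>c * S N\<close> can be moved to the left.\<close>

lemma le_upto_const_absorb:
  assumes "S \<lesssim>\<^sub>c (\<lambda>N. c * S N + T N)" "c < 1"
  shows "S \<lesssim>\<^sub>c (\<lambda>N. T N / (1 - c))"
proof -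
  obtain C where C: "\<And>N. S N \<le> C + (c * S N + T N)"
    using assms unfolding le_upto_const_def by blast
  have "S N \<le> C / (1 - c) + T N / (1 - c)" for N
    using C[of N] \<open>c < 1\<close>
    by (simp add: pos_le_divide_eq algebra_simps flip: add_divide_distrib)
  then show ?thesis
    by (rule le_upto_constI)
qed

lemma energy_nonneg: "0 \<le> energy a N"
  by (simp add: energy_def sum_nonneg)

section \<open>Gains of first-order and second-order filters\<close>

lemma power2_norm_add_le:
  fixes x y :: "'a::real_normed_vector"
  shows "(norm (x + y))\<^sup>2 \<le> 2 * (norm x)\<^sup>2 + 2 * (norm y)\<^sup>2"
proof -
  have "(norm (x + y))\<^sup>2 \<le> (norm x + norm y)\<^sup>2"
    by (intro power_mono norm_triangle_ineq) auto
  also have "\<dots> \<le> 2 * (norm x)\<^sup>2 + 2 * (norm y)\<^sup>2"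
    using sum_squares_bound[of "norm x" "norm y"] by (simp add: power2_sum)
  finally show ?thesis .
qed

text \<open>The filter \<open>1 / (z - l)\<close> has l2 gain at most \<open>1 / (1 - r)\<close>.
  Convexity of the square gives a one-step decay estimate, which is then summed.\<close>

lemma energy_filter:
  fixes a b :: "nat \<Rightarrow> 'a::real_normed_div_algebra"
  assumes rec: "\<And>k. a (Suc k) = l * a k + b k" and r: "norm l \<le> r" "r < 1"
  shows "energy a \<lesssim>\<^sub>c (\<lambda>N. energy b N / (1 - r)\<^sup>2)"
proof -
  have r0: "0 \<le> r" and p: "0 < 1 - r"
    using r norm_ge_zero[of l] by linarith+
  have step: "(norm (a (Suc k)))\<^sup>2 \<le> r * (norm (a k))\<^sup>2 + (norm (b k))\<^sup>2 / (1 - r)" for k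
  proof -
    \<comment> \<open>Dividing by \<open>1 - r\<close> turns the bound on \<open>a (Suc k)\<close>
      into a convex combination of \<open>?x\<close> and \<open>?y\<close>.\<close>
    let ?x = "norm (a k)" and ?y = "norm (b k) / (1 - r)"
    have "norm (a (Suc k)) \<le> norm l * norm (a k) + norm (b k)"
      unfolding rec by (rule norm_triangle_le) (simp add: norm_mult)
    also have "\<dots> \<le> r * ?x + (1 - r) * ?y"
      using r p by (intro add_mono mult_right_mono) auto
    finally have "(norm (a (Suc k)))\<^sup>2 \<le> (r * ?x + (1 - r) * ?y)\<^sup>2"
      by (intro power_mono) auto
    also have "\<dots> = r * ?x\<^sup>2 + (1 - r) * ?y\<^sup>2 - r * (1 - r) * (?x - ?y)\<^sup>2"
      by algebra
    also have "\<dots> \<le> r * ?x\<^sup>2 + (1 - r) * ?y\<^sup>2"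
      using r0 p by simp
    also have "(1 - r) * ?y\<^sup>2 = (norm (b k))\<^sup>2 / (1 - r)"
      using p by (simp add: power2_eq_square)
    finally show ?thesis .
  qed
  \<comment> \<open>The last square is kept on the left because the induction step consumes
    it.\<close>
  have tele: "(1 - r) * energy a N + (norm (a N))\<^sup>2 \<le> (norm (a 0))\<^sup>2 + energy b N / (1 - r)" for N
  proof (induction N)
    case (Suc N)
    then show ?case
      using step[of N] by (simp add: energy_def distrib_left add_divide_distrib algebra_simps)
  qed (simp add: energy_def)
  have "energy a N \<le> (norm (a 0))\<^sup>2 / (1 - r) + energy b N / (1 - r)\<^sup>2" for N
  proof -
    have "(1 - r) * energy a N \<le> (norm (a 0))\<^sup>2 + energy b N / (1 - r)"
      using tele[of N] zero_le_power2[of "norm (a N)"] by linarith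
    then have "energy a N \<le> ((norm (a 0))\<^sup>2 + energy b N / (1 - r)) / (1 - r)"
      using p by (simp add: pos_le_divide_eq mult.commute)
    then show ?thesis
      by (simp add: add_divide_distrib power2_eq_square)
  qed
  then show ?thesis
    by (rule le_upto_constI)
qed

text \<open>The characteristic polynomial factors, so \<open>x (Suc k) - l2 * x k\<close> is the
  output of a first-order filter with root \<open>l1\<close> driven by \<open>- u\<close>, and it
  drives in turn a filter with root \<open>l2\<close> whose output is \<open>x\<close>.\<close>

lemma second_order_energy:
  fixes x u :: "nat \<Rightarrow> 'a::real_normed_field"
  assumes rec: "\<And>k. x (Suc (Suc k)) = (l1 + l2) * x (Suc k) - l1 * l2 * x k - u k"
    and r: "norm l1 \<le> r" "norm l2 \<le> r" "r < 1"
  shows "energy (\<lambda>k. x (Suc k) - l2 * x k) \<lesssim>\<^sub>c (\<lambda>N. energy u N / (1 - r)\<^sup>2)" (is ?A)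
    and "energy x \<lesssim>\<^sub>c (\<lambda>N. energy u N / (1 - r) ^ 4)" (is ?B)
proof -
  have "energy (\<lambda>k. x (Suc k) - l2 * x k) \<lesssim>\<^sub>c (\<lambda>N. energy (\<lambda>k. - u k) N / (1 - r)\<^sup>2)"
    by (rule energy_filter[where l = l1]) (use r in \<open>auto simp: rec algebra_simps\<close>)
  then show A: ?A
    by (simp add: energy_def)
  have "energy x \<lesssim>\<^sub>c (\<lambda>N. energy (\<lambda>k. x (Suc k) - l2 * x k) N / (1 - r)\<^sup>2)"
    by (rule energy_filter[where l = l2]) (use r in auto)
  also have "\<dots> \<lesssim>\<^sub>c (\<lambda>N. energy u N / (1 - r)\<^sup>2 / (1 - r)\<^sup>2)"
    using le_upto_const_cmult[OF _ A, of "1 / (1 - r)\<^sup>2"] by simp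
  finally show ?B
    by (simp flip: power_add)
qed

text \<open>The constant 12 does not degrade when the two roots approach each other or 1:
  for real roots \<open>(z - 1) / (z - l2)\<close> has gain at most 2, and for conjugate roots the gain of
  \<open>Im l / ((z - l) * (z - cnj l))\<close> is bounded by partial fractions.\<close>

lemma second_order_difference_energy:
  fixes x u :: "nat \<Rightarrow> complex"
  assumes rec: "\<And>k. x (Suc (Suc k)) = (l1 + l2) * x (Suc k) - l1 * l2 * x k - u k"
    and r: "norm l1 \<le> r" "norm l2 \<le> r" "r < 1"
    and roots: "(l2 \<in> \<real> \<and> 0 \<le> Re l2) \<or> (l1 = cnj l2 \<and> 1 - Re l2 \<le> 1 - (cmod l2)\<^sup>2)"
  shows "energy (\<lambda>k. x (Suc k) - x k) \<lesssim>\<^sub>c (\<lambda>N. 12 * (energy u N / (1 - r)\<^sup>2))"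
proof -
  let ?U = "\<lambda>N. energy u N / (1 - r)\<^sup>2"
  define d where "d k = x (Suc k) - l2 * x k" for k
  have d: "energy d \<lesssim>\<^sub>c ?U"
    unfolding d_def by (rule second_order_energy(1)[of x l1 l2 u, OF rec r])
  have p: "0 < 1 - r" using r by simp
  \<comment> \<open>The increment of \<open>x\<close> is \<open>d k + (l2 - 1) * x k\<close>. With
    gain 1 for \<open>d\<close> and 5 for the second summand, the final constant is 2 * 1 + 2 * 5 =
    12.\<close>
  have main: "(\<lambda>N. (cmod (l2 - 1))\<^sup>2 * energy x N) \<lesssim>\<^sub>c (\<lambda>N. 5 * ?U N)"
    using roots
  proof (elim disjE conjE)
    assume "l2 \<in> \<real>" "0 \<le> Re l2"
    then obtain t where t: "l2 = of_real t" "0 \<le> t"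
      by (auto elim!: Reals_cases)
    have t1: "t < 1" using r t by simp
    \<comment> \<open>The filter bound is taken with the root \<open>t\<close> itself instead of
      \<open>r\<close>, so that its gain cancels \<open>1 - t\<close> exactly.\<close>
    have "energy x \<lesssim>\<^sub>c (\<lambda>N. energy d N / (1 - t)\<^sup>2)"
      by (rule energy_filter[where l = l2]) (use t t1 in \<open>auto simp: d_def\<close>)
    then have "(\<lambda>N. (1 - t)\<^sup>2 * energy x N) \<lesssim>\<^sub>c (\<lambda>N. (1 - t)\<^sup>2 * (energy d N / (1 - t)\<^sup>2))"
      by (rule le_upto_const_cmult[rotated]) simp
    also have "(\<lambda>N. (1 - t)\<^sup>2 * (energy d N / (1 - t)\<^sup>2)) = energy d"
      using t1 by simp
    also note d
    also have "?U \<lesssim>\<^sub>c (\<lambda>N. 5 * ?U N)"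
    proof (rule le_upto_const_mono)
      fix N
      have "0 \<le> ?U N" by (simp add: energy_nonneg)
      then show "?U N \<le> 5 * ?U N" by linarith
    qed
    finally have "(\<lambda>N. (1 - t)\<^sup>2 * energy x N) \<lesssim>\<^sub>c (\<lambda>N. 5 * ?U N)" .
    moreover have "cmod (l2 - 1) = 1 - t"
      using t1 t by (metis abs_minus_commute abs_of_pos diff_gt_0_iff_gt norm_of_real of_real_1 of_real_diff)
    ultimately show ?thesis by simp
  next
    assume l1: "l1 = cnj l2" and sec: "1 - Re l2 \<le> 1 - (cmod l2)\<^sup>2"
    define a b where "a = Re l2" and "b = Im l2"
    \<comment> \<open>The other first-order factor. The difference of \<open>e\<close> and
      \<open>d\<close> isolates \<open>x\<close> times twice the imaginary part of the root: this is
      the partial fraction decomposition.\<close>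
    define e where "e k = x (Suc k) - l1 * x k" for k
    have e: "energy e \<lesssim>\<^sub>c ?U"
      unfolding e_def using second_order_energy(1)[of x l2 l1 u] rec r
      by (simp add: add.commute mult.commute)
    have "b\<^sup>2 * (cmod (x k))\<^sup>2 \<le> ((cmod (d k))\<^sup>2 + (cmod (e k))\<^sup>2) / 2" for k
    proof -
      have "e k + - d k = (l2 - l1) * x k"
        by (simp add: d_def e_def algebra_simps)
      also have "cmod \<dots> = 2 * \<bar>b\<bar> * cmod (x k)"
        by (simp add: l1 b_def norm_mult complex_diff_cnj)
      finally have "(2 * \<bar>b\<bar> * cmod (x k))\<^sup>2 \<le> 2 * (cmod (e k))\<^sup>2 + 2 * (cmod (- d k))\<^sup>2"
        using power2_norm_add_le[of "e k" "- d k"] by simp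
      then show ?thesis
        by (simp add: power_mult_distrib)
    qed
    then have "b\<^sup>2 * energy x N \<le> (energy d N + energy e N) / 2" for N
      unfolding energy_def sum_distrib_left sum.distrib[symmetric] sum_divide_distrib
      by (rule sum_mono)
    then have "(\<lambda>N. b\<^sup>2 * energy x N) \<lesssim>\<^sub>c (\<lambda>N. 1 / 2 * (energy d N + energy e N))"
      by (intro le_upto_const_mono) simp
    also have "\<dots> \<lesssim>\<^sub>c (\<lambda>N. 1 / 2 * (?U N + ?U N))"
      by (intro le_upto_const_cmult le_upto_const_add d e) simp
    finally have im: "(\<lambda>N. b\<^sup>2 * energy x N) \<lesssim>\<^sub>c ?U" by simp
    \<comment> \<open>Conjugate roots share their modulus, so the double filter may use the true gap
      \<open>q\<close>. As \<open>1 - a\<close> is at most \<open>2 * q\<close>, two of the four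
      powers of \<open>q\<close> cancel before \<open>q\<close> is compared with
      \<open>1 - r\<close>.\<close>
    define q where "q = 1 - cmod l2"
    have q: "1 - r \<le> q" "0 < q" using r by (auto simp: q_def)
    have re: "(\<lambda>N. (1 - a)\<^sup>2 * energy x N) \<lesssim>\<^sub>c (\<lambda>N. 4 * ?U N)"
    proof -
      have "a \<le> 1"
        using complex_Re_le_cmod[of l2] r by (simp add: a_def)
      moreover have "1 - a \<le> 2 * q"
      proof -
        have "1 - (cmod l2)\<^sup>2 = q * (1 + cmod l2)"
          by (simp add: q_def power2_eq_square algebra_simps)
        also have "\<dots> \<le> q * 2"
          using q r by (intro mult_left_mono) auto
        finally show ?thesis using sec by (simp add: a_def)
      qed
      ultimately have "(1 - a)\<^sup>2 \<le> (2 * q)\<^sup>2"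
        by (intro power_mono) auto
      then have "(\<lambda>N. (1 - a)\<^sup>2 * energy x N) \<lesssim>\<^sub>c (\<lambda>N. (2 * q)\<^sup>2 * energy x N)"
        by (intro le_upto_const_mono mult_right_mono energy_nonneg)
      also have "\<dots> \<lesssim>\<^sub>c (\<lambda>N. (2 * q)\<^sup>2 * (energy u N / q ^ 4))"
        unfolding q_def using r
        by (intro le_upto_const_cmult second_order_energy(2)[of x l1 l2 u, OF rec]) (auto simp: l1)
      also have "(2 * q)\<^sup>2 * (energy u N / q ^ 4) \<le> 4 * ?U N" for N
      proof -
        have "(2 * q)\<^sup>2 * (energy u N / q ^ 4) = 4 * (energy u N / q\<^sup>2)"
          using q by (simp add: power2_eq_square power4_eq_xxxx)
        also have "\<dots> \<le> 4 * ?U N"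
          using q p by (intro mult_left_mono divide_left_mono power_mono energy_nonneg) auto
        finally show ?thesis .
      qed
      then have "(\<lambda>N. (2 * q)\<^sup>2 * (energy u N / q ^ 4)) \<lesssim>\<^sub>c (\<lambda>N. 4 * ?U N)"
        by (rule le_upto_const_mono)
      finally show ?thesis .
    qed
    have "(cmod (l2 - 1))\<^sup>2 = (1 - a)\<^sup>2 + b\<^sup>2"
      by (simp add: cmod_power2 a_def b_def power2_commute)
    then show ?thesis
      using le_upto_const_add[OF re im] by (simp add: distrib_right)
  qed
  have "(cmod (x (Suc k) - x k))\<^sup>2 \<le> 2 * (cmod (d k))\<^sup>2 + 2 * ((cmod (l2 - 1))\<^sup>2 * (cmod (x k))\<^sup>2)" for k
  proof -
    have "x (Suc k) - x k = d k + (l2 - 1) * x k"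
      by (simp add: d_def algebra_simps)
    then show ?thesis
      using power2_norm_add_le[of "d k" "(l2 - 1) * x k"]
      by (simp add: norm_mult power_mult_distrib)
  qed
  then have "energy (\<lambda>k. x (Suc k) - x k) N
      \<le> 2 * energy d N + 2 * ((cmod (l2 - 1))\<^sup>2 * energy x N)" for N
    unfolding energy_def sum_distrib_left sum.distrib[symmetric] by (rule sum_mono)
  then have "energy (\<lambda>k. x (Suc k) - x k)
      \<lesssim>\<^sub>c (\<lambda>N. 2 * energy d N + 2 * ((cmod (l2 - 1))\<^sup>2 * energy x N))"
    by (rule le_upto_const_mono)
  also have "\<dots> \<lesssim>\<^sub>c (\<lambda>N. 2 * ?U N + 2 * (5 * ?U N))"
    by (intro le_upto_const_add le_upto_const_cmult d main) auto
  finally show ?thesis by simp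
qed

text \<open>The roots of the characteristic quadratic meet the dichotomy of
  \<open>second_order_difference_energy\<close>: if real, the smaller one is nonnegative because
  \<open>v\<close> is positive; if conjugate, their squared modulus \<open>v\<close> is at most
  their real part.\<close>

lemma mode_energy:
  fixes x u :: "nat \<Rightarrow> real"
  assumes rec: "\<And>k. x (Suc (Suc k)) = (1 + w) * x (Suc k) - v * x k - u k"
    and w: "- 1 < w" "w < 1" and \<theta>: "\<theta> \<le> 1 / 2" and v: "v = \<theta> + (1 - \<theta>) * w" "0 < v"
    and r: "\<And>l :: complex. l\<^sup>2 - (1 + of_real w) * l + of_real v = 0 \<Longrightarrow> cmod l \<le> r" "r < 1"
  shows "energy x \<lesssim>\<^sub>c (\<lambda>N. energy u N / (1 - r) ^ 4)"
    and "energy (\<lambda>k. x (Suc k) - x k) \<lesssim>\<^sub>c (\<lambda>N. 12 * (energy u N / (1 - r)\<^sup>2))"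
proof -
  define D where "D = (1 + w)\<^sup>2 - 4 * v"
  define s :: complex where "s = csqrt (of_real D)"
  define l1 l2 where "l1 = (1 + of_real w + s) / 2" and "l2 = (1 + of_real w - s) / 2"
  have s2: "s\<^sup>2 = (1 + of_real w)\<^sup>2 - 4 * of_real v"
    by (simp add: s_def D_def)
  have sum: "l1 + l2 = 1 + of_real w"
    by (simp add: l1_def l2_def field_simps)
  have prod: "l1 * l2 = of_real v"
  proof -
    have "l1 * l2 = ((1 + of_real w)\<^sup>2 - s\<^sup>2) / 4"
      by (simp add: l1_def l2_def power2_eq_square field_simps)
    then show ?thesis by (simp add: s2)
  qed
  have root: "l\<^sup>2 - (1 + of_real w) * l + of_real v = (l - l1) * (l - l2)" for l
    unfolding sum[symmetric] prod[symmetric] by algebra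
  have l: "cmod l1 \<le> r" "cmod l2 \<le> r"
    by (auto intro!: r simp: root)
  have roots: "(l2 \<in> \<real> \<and> 0 \<le> Re l2) \<or> (l1 = cnj l2 \<and> 1 - Re l2 \<le> 1 - (cmod l2)\<^sup>2)"
  proof (cases "0 \<le> D")
    case True
    then have s: "s = of_real (sqrt D)"
      by (simp add: s_def csqrt_of_real_nonneg)
    have "sqrt D \<le> sqrt ((1 + w)\<^sup>2)"
      using v(2) by (intro real_sqrt_le_mono) (simp add: D_def)
    then have nonneg: "0 \<le> (1 + w - sqrt D) / 2"
      using w by simp
    have l2: "l2 = of_real ((1 + w - sqrt D) / 2)"
      by (simp add: l2_def s)
    have "l2 \<in> \<real> \<and> 0 \<le> Re l2"
      unfolding l2 Re_complex_of_real by (intro conjI Reals_of_real nonneg)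
    then show ?thesis by simp
  next
    case False
    then have s: "s = \<i> * of_real (sqrt (- D))"
      by (simp add: s_def csqrt_of_real_nonpos)
    have cnj: "l1 = cnj l2"
      by (simp add: l1_def l2_def s)
    then have "of_real ((cmod l2)\<^sup>2) = (of_real v :: complex)"
      using prod by (metis complex_norm_square mult.commute of_real_power)
    then have "(cmod l2)\<^sup>2 = v"
      using of_real_eq_iff by blast
    moreover have "Re l2 = (1 + w) / 2"
      by (simp add: l2_def s)
    \<comment> \<open>Here the bound on \<theta> enters.\<close>
    moreover have "v \<le> (1 + w) / 2"
    proof -
      have "(1 + w) / 2 - v = (1 / 2 - \<theta>) * (1 - w)"
        by (simp add: v field_simps)
      then show ?thesis
        using \<theta> w by (smt (verit) mult_nonneg_nonneg)
    qed
    ultimately show ?thesis using cnj by simp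
  qed
  \<comment> \<open>The roots may be complex, so the sequences are embedded isometrically into the
    complex numbers.\<close>
  define X U where "X k = complex_of_real (x k)" and "U k = complex_of_real (u k)" for k
  have recX: "X (Suc (Suc k)) = (l1 + l2) * X (Suc k) - l1 * l2 * X k - U k" for k
    unfolding sum prod X_def U_def rec by simp
  have eq: "energy X = energy x" "energy U = energy u"
    "energy (\<lambda>k. X (Suc k) - X k) = energy (\<lambda>k. x (Suc k) - x k)"
    by (simp_all add: energy_def fun_eq_iff X_def U_def flip: of_real_diff)
  show "energy x \<lesssim>\<^sub>c (\<lambda>N. energy u N / (1 - r) ^ 4)"
    using second_order_energy(2)[of X l1 l2 U, OF recX l r(2)] by (simp add: eq)
  show "energy (\<lambda>k. x (Suc k) - x k) \<lesssim>\<^sub>c (\<lambda>N. 12 * (energy u N / (1 - r)\<^sup>2))"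
    using second_order_difference_energy[of X l1 l2 U, OF recX l r(2) roots] by (simp add: eq)
qed

section \<open>Gradients\<close>

lemma GDERIV_unique:
  assumes "GDERIV f x :> D" "GDERIV f x :> E"
  shows "D = E"
proof -
  have "(\<lambda>h. h \<bullet> D) = (\<lambda>h. h \<bullet> E)"
    using assms unfolding gderiv_def by (rule has_derivative_unique)
  then have "(D - E) \<bullet> D = (D - E) \<bullet> E"
    by metis
  then show ?thesis
    by (metis eq_iff_diff_eq_0 inner_diff_right inner_eq_zero_iff)
qed

lemma grad_eqI: "GDERIV f x :> D \<Longrightarrow> grad f x = D"
  unfolding grad_def by (blast intro: the_equality GDERIV_unique)

text \<open>The Riesz representative of the derivative \<open>D\<close> is
  \<open>adjoint D 1\<close>.\<close>

lemma GDERIV_grad: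
  fixes f :: "'a::euclidean_space \<Rightarrow> real"
  assumes "f differentiable (at x)"
  shows "GDERIV f x :> grad f x"
proof -
  obtain D where D: "(f has_derivative D) (at x)"
    using assms by (auto simp: differentiable_def)
  have "D h = h \<bullet> adjoint D 1" for h
    unfolding adjoint_works[OF has_derivative_linear[OF D]] inner_real_def mult_1_right ..
  then have "D = (\<lambda>h. h \<bullet> adjoint D 1)" ..
  then have "GDERIV f x :> adjoint D 1"
    using D unfolding gderiv_def by (rule subst[where P = "\<lambda>D. (f has_derivative D) (at x)"])
  then show ?thesis
    using grad_eqI by metis
qed

text \<open>On the segment from \<open>x\<close> to \<open>y\<close>, the gap \<open>h\<close>
  between \<open>f\<close> and its quadratic upper model has nonpositive derivative by the Lipschitz
  bound; comparing its end values gives the claim.\<close>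

lemma descent_lemma:
  fixes f :: "'a::real_inner \<Rightarrow> real"
  assumes g: "\<And>x. GDERIV f x :> g x"
    and lip: "\<And>x y. norm (g x - g y) \<le> L * norm (x - y)"
  shows "f y \<le> f x + g x \<bullet> (y - x) + L / 2 * (norm (y - x))\<^sup>2"
proof -
  let ?d = "y - x"
  define h where "h t = f (x + t *\<^sub>R ?d) - t * (g x \<bullet> ?d) - L / 2 * t\<^sup>2 * (norm ?d)\<^sup>2" for t
  define h' where "h' t = ?d \<bullet> g (x + t *\<^sub>R ?d) - g x \<bullet> ?d - L * t * (norm ?d)\<^sup>2" for t
  have der: "(h has_real_derivative h' t) (at t)" for t
  proof -
    have "((\<lambda>t. x + t *\<^sub>R ?d) has_derivative (\<lambda>s. s *\<^sub>R ?d)) (at t)"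
      by (auto intro!: derivative_eq_intros)
    then have "((\<lambda>t. f (x + t *\<^sub>R ?d)) has_derivative (\<lambda>s. (s *\<^sub>R ?d) \<bullet> g (x + t *\<^sub>R ?d))) (at t)"
      by (rule has_derivative_compose) (use g gderiv_def in blast)
    then have [derivative_intros]:
      "((\<lambda>t. f (x + t *\<^sub>R ?d)) has_real_derivative ?d \<bullet> g (x + t *\<^sub>R ?d)) (at t)"
      by (simp add: has_field_derivative_def mult_commute_abs)
    show ?thesis
      unfolding h_def h'_def by (auto intro!: derivative_eq_intros)
  qed
  have "h' t \<le> 0" if "0 \<le> t" for t
  proof -
    have "(g (x + t *\<^sub>R ?d) - g x) \<bullet> ?d \<le> norm (g (x + t *\<^sub>R ?d) - g x) * norm ?d"
      by (rule norm_cauchy_schwarz)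
    also have "\<dots> \<le> L * norm (t *\<^sub>R ?d) * norm ?d"
      using lip[of "x + t *\<^sub>R ?d" x] by (intro mult_right_mono) auto
    also have "\<dots> = L * t * (norm ?d)\<^sup>2"
      using that by (simp add: power2_eq_square)
    finally show ?thesis
      unfolding h'_def inner_commute[of ?d] inner_diff_left[of _ _ ?d] by linarith
  qed
  then have "h 1 \<le> h 0"
    using der by (intro DERIV_nonpos_imp_nonincreasing[of 0 1 h]) auto
  then show ?thesis
    by (simp add: h_def)
qed

text \<open>The sublevel set through an arbitrary point (here \<open>undefined\<close>) is compact
  and nonempty, and the minimum over it is global.\<close>

lemma coercive_bounded_below:
  fixes f :: "'a::topological_space \<Rightarrow> real"
  assumes "coercive f" "continuous_on UNIV f"
  shows "\<exists>m. \<forall>x. m \<le> f x"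
proof -
  let ?K = "{x. f x \<le> f undefined}"
  have "compact ?K" "?K \<noteq> {}" "continuous_on ?K f"
    using assms by (auto simp: coercive_def intro: continuous_on_subset)
  then obtain y where y: "y \<in> ?K" "\<And>x. x \<in> ?K \<Longrightarrow> f y \<le> f x"
    using continuous_attains_inf by metis
  have "f y \<le> f x" for x
    using y(1) y(2)[of x] by (cases "x \<in> ?K") auto
  then show ?thesis by blast
qed

section \<open>The separable objective on stacked vectors\<close>

lemma bounded_linear_block: "bounded_linear (\<lambda>x. block x i)"
  unfolding linear_conv_bounded_linear[symmetric]
  by (rule linearI) (simp_all add: block_def vec_eq_iff)

lemma inner_block: "x \<bullet> y = (\<Sum>i\<in>UNIV. block x i \<bullet> block y i)"
  by (simp add: inner_vec_def block_def sum.cartesian_product flip: UNIV_Times_UNIV)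

lemma norm_power2_block: "(norm x)\<^sup>2 = (\<Sum>i\<in>UNIV. (norm (block x i))\<^sup>2)"
  by (simp add: inner_block power2_norm_eq_inner)

lemma GDERIV_F_sum:
  fixes f :: "'m::finite \<Rightarrow> real ^ 'n::finite \<Rightarrow> real"
  assumes "\<And>i y. f i differentiable (at y)"
  shows "GDERIV (F_sum f) x :> (\<chi> p. grad (f (fst p)) (block x (fst p)) $ snd p)"
proof -
  let ?g = "\<chi> p. grad (f (fst p)) (block x (fst p)) $ snd p"
  have "block ?g i = grad (f i) (block x i)" for i
    by (simp add: block_def vec_eq_iff)
  then have inner: "h \<bullet> ?g = (\<Sum>i\<in>UNIV. block h i \<bullet> grad (f i) (block x i))" for h
    by (simp add: inner_block)
  have "((\<lambda>x. f i (block x i)) has_derivative (\<lambda>h. block h i \<bullet> grad (f i) (block x i))) (at x)" for i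
    using bounded_linear_imp_has_derivative[OF bounded_linear_block]
    by (rule has_derivative_compose) (use GDERIV_grad[OF assms] gderiv_def in blast)
  then show ?thesis
    unfolding gderiv_def inner F_sum_def[abs_def] by (rule has_derivative_sum)
qed

lemma block_grad_F_sum:
  assumes "\<And>i y. f i differentiable (at y)"
  shows "block (grad (F_sum f) x) i = grad (f i) (block x i)"
  by (simp add: grad_eqI[OF GDERIV_F_sum[OF assms]] block_def vec_eq_iff)

text \<open>A unit basis vector is tested against the origin; a Euclidean space always has
  one.\<close>

lemma lipschitz_constant_nonneg:
  fixes h :: "'a::euclidean_space \<Rightarrow> 'b::real_normed_vector"
  assumes "\<And>y z. norm (h y - h z) \<le> L * norm (y - z)"
  shows "0 \<le> L"
proof -
  obtain b :: 'a where "b \<in> Basis"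
    using nonempty_Basis by blast
  then show ?thesis
    using order_trans[OF norm_ge_zero assms[of b 0]] by simp
qed

text \<open>The gradient acts blockwise and squared norms add over blocks, so the common constant
  survives without a factor depending on the number of agents.\<close>

lemma grad_F_sum_lipschitz:
  fixes f :: "'m::finite \<Rightarrow> real ^ 'n::finite \<Rightarrow> real"
  assumes diff: "\<And>i y. f i differentiable (at y)"
    and lip: "\<And>i y z. norm (grad (f i) y - grad (f i) z) \<le> L * norm (y - z)"
  shows "norm (grad (F_sum f) x - grad (F_sum f) y) \<le> L * norm (x - y)"
proof -
  interpret block: bounded_linear "\<lambda>x :: real ^ ('m \<times> 'n). block x i" for i
    by (rule bounded_linear_block)
  have "0 \<le> L"
    by (rule lipschitz_constant_nonneg[OF lip])
  have "(norm (grad (F_sum f) x - grad (F_sum f) y))\<^sup>2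
      \<le> (\<Sum>i\<in>UNIV. (L * norm (block (x - y) i))\<^sup>2)"
    unfolding norm_power2_block[of "grad (F_sum f) x - grad (F_sum f) y"]
    by (intro sum_mono power_mono) (simp_all add: block.diff block_grad_F_sum diff lip)
  also have "\<dots> = (L * norm (x - y))\<^sup>2"
    by (simp add: power_mult_distrib norm_power2_block[of "x - y"] sum_distrib_left)
  finally show ?thesis
    using \<open>0 \<le> L\<close> by (simp add: power2_le_iff_abs_le)
qed

lemma F_sum_bounded_below:
  fixes f :: "'m::finite \<Rightarrow> real ^ 'n::finite \<Rightarrow> real"
  assumes diff: "\<And>i y. f i differentiable (at y)" and co: "\<And>i. coercive (f i)"
  shows "\<exists>m. \<forall>x. m \<le> F_sum f x"
proof -
  have "\<exists>m. \<forall>x. m \<le> f i x" for i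
  proof -
    have "continuous_on UNIV (f i)"
      using diff by (intro continuous_at_imp_continuous_on ballI differentiable_imp_continuous_within)
    then show ?thesis
      by (rule coercive_bounded_below[OF co])
  qed
  then obtain m where "\<And>i x. m i \<le> f i x" by metis
  then have "(\<Sum>i\<in>UNIV. m i) \<le> F_sum f x" for x
    unfolding F_sum_def by (rule sum_mono)
  then show ?thesis by blast
qed

section \<open>Kronecker products and the spectrum of \<open>P_mat\<close>\<close>

text \<open>Complementary to \<open>block\<close>: the coordinate is fixed and the agent varies, so
  \<open>A \<otimes>\<^sub>K mat 1\<close> acts on every slice as \<open>A\<close>.\<close>

definition slice :: "real ^ ('m::finite \<times> 'n::finite) \<Rightarrow> 'n \<Rightarrow> real ^ 'm" where
  "slice x k = (\<chi> i. x $ (i, k))"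

lemma slice_eqI: "(\<And>k. slice x k = slice y k) \<Longrightarrow> x = y"
  by (auto simp: slice_def vec_eq_iff)

lemma linear_slice: "linear (\<lambda>x. slice x k)"
  by (rule linearI) (simp_all add: slice_def vec_eq_iff)

lemmas slice_simps [simp] = linear_0[OF linear_slice] linear_add[OF linear_slice]
  linear_diff[OF linear_slice] linear_scale[OF linear_slice]

lemma inner_slice: "x \<bullet> y = (\<Sum>k\<in>UNIV. slice x k \<bullet> slice y k)"
  unfolding inner_vec_def slice_def vec_lambda_beta
  by (subst sum.swap) (simp add: sum.cartesian_product flip: UNIV_Times_UNIV)

lemma slice_kronecker_mat1 [simp]: "slice ((A \<otimes>\<^sub>K mat 1) *v x) k = A *v slice x k"
proof -
  have "(\<Sum>q\<in>UNIV. A $ i $ fst q * (mat 1 :: real ^ 'b ^ 'b) $ k $ snd q * x $ q)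
      = (\<Sum>j\<in>UNIV. A $ i $ j * x $ (j, k))" for i
  proof -
    have "(\<Sum>q\<in>UNIV. A $ i $ fst q * (mat 1 :: real ^ 'b ^ 'b) $ k $ snd q * x $ q)
      = (\<Sum>j\<in>UNIV. \<Sum>l\<in>UNIV. A $ i $ j * (mat 1 :: real ^ 'b ^ 'b) $ k $ l * x $ (j, l))"
      by (simp add: sum.cartesian_product case_prod_unfold flip: UNIV_Times_UNIV)
    then show ?thesis
      by (simp add: mat_def if_distrib if_distribR cong: if_cong)
  qed
  then show ?thesis
    by (simp add: slice_def kronecker_def matrix_vector_mult_def vec_eq_iff)
qed

lemma inner_symmetric_matrix:
  fixes A :: "real ^ 'n ^ 'n"
  assumes "transpose A = A"
  shows "(A *v x) \<bullet> y = x \<bullet> (A *v y)"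
  using dot_lmul_matrix[of x A y] assms by (metis transpose_matrix_vector)

lemma inner_symmetric_kronecker:
  "transpose A = A \<Longrightarrow> ((A \<otimes>\<^sub>K mat 1) *v x) \<bullet> y = x \<bullet> ((A \<otimes>\<^sub>K mat 1) *v y)"
  by (simp add: inner_slice inner_symmetric_matrix)

section \<open>The averaging projection\<close>

lemma ones_fixed_if_null_space:
  assumes "null_space (mat 1 - W) = span {ones}"
  shows "W *v ones = ones"
proof -
  have "ones \<in> null_space (mat 1 - W)"
    unfolding assms by (simp add: span_base)
  then show ?thesis
    by (simp add: null_space_def matrix_vector_mult_diff_rdistrib)
qed

lemma avg_mat_vec: "avg_mat *v v = (ones \<bullet> v / real CARD('m)) *\<^sub>R ones"
  for v :: "real ^ 'm"
  by (simp add: avg_mat_def ones_def matrix_vector_mult_def inner_vec_def vec_eq_iff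
      sum_divide_distrib)

lemma avg_mat_ones [simp]: "avg_mat *v ones = ones"
  by (simp add: avg_mat_vec) (simp add: ones_def inner_vec_def)

lemma transpose_avg_mat: "transpose avg_mat = avg_mat"
  by (simp add: avg_mat_def transpose_def vec_eq_iff mult.commute)

lemma avg_mat_idem [simp]: "avg_mat *v (avg_mat *v v) = avg_mat *v v"
  unfolding avg_mat_vec[of v] by (simp add: matrix_vector_mult_scaleR)

lemma avg_mat_commute:
  assumes "transpose W = W" "W *v ones = ones"
  shows "avg_mat *v (W *v v) = avg_mat *v v"
  using inner_symmetric_matrix[OF assms(1), of ones v] assms(2) by (simp add: avg_mat_vec)

lemma sum_UNIV_Plus:
  "(\<Sum>p\<in>UNIV. g p) = (\<Sum>i\<in>UNIV. g (Inl i)) + (\<Sum>j\<in>UNIV. g (Inr j))"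
  for g :: "'a::finite + 'b::finite \<Rightarrow> 'c::comm_monoid_add"
  unfolding UNIV_Plus_UNIV[symmetric] by (subst sum.Plus) (auto simp: o_def)

text \<open>The first block row forces an eigenvector of the form (\<open>e\<close>,
  \<open>(l - w) * e\<close>); the second block row is then the quadratic equation. The averaging
  matrix drops out, since \<open>e\<close> is orthogonal to \<open>ones\<close>, whose eigenvalue is
  1.\<close>

lemma root_in_spectrum_P_mat:
  fixes W V :: "real ^ 'm ^ 'm" and l :: complex
  assumes sym: "transpose W = W" and one: "W *v ones = ones"
    and V: "V = \<theta> *\<^sub>R mat 1 + (1 - \<theta>) *\<^sub>R W"
    and e: "W *v e = w *\<^sub>R e" "e \<noteq> 0" "w \<noteq> 1"
    and l: "l\<^sup>2 - (1 + of_real w) * l + of_real (\<theta> + (1 - \<theta>) * w) = 0"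
  shows "l \<in> spectrum (P_mat W V)"
proof -
  define z :: "complex ^ ('m + 'm)" where
    "z = (\<chi> p. case p of Inl i \<Rightarrow> of_real (e $ i) | Inr i \<Rightarrow> (l - of_real w) * of_real (e $ i))"
  have "w * (ones \<bullet> e) = ones \<bullet> e"
    using inner_symmetric_matrix[OF sym, of ones e] one e by simp
  then have avg: "avg_mat *v e = 0"
    using e by (simp add: avg_mat_vec)
  have Ve: "V *v e = (\<theta> + (1 - \<theta>) * w) *\<^sub>R e"
    by (simp add: V e matrix_vector_mult_add_rdistrib scaleR_matrix_vector_assoc[symmetric] algebra_simps)
  have cplx: "(\<Sum>j\<in>UNIV. of_real (A $ i $ j) * of_real (e $ j)) = (of_real ((A *v e) $ i) :: complex)"
    for A :: "real ^ 'm ^ 'm" and i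
    by (simp add: matrix_vector_mult_def)
  have "map_matrix of_real (P_mat W V) *v z = l *s z"
  proof -
    have "(map_matrix of_real (P_mat W V) *v z) $ p = l * z $ p" for p
    proof (cases p)
      case (Inl i)
      have "(map_matrix of_real (P_mat W V) *v z) $ p
          = of_real (((W - avg_mat) *v e) $ i) + (l - of_real w) * of_real ((mat 1 *v e) $ i)"
        unfolding Inl cplx[symmetric] sum_distrib_left
        by (simp add: P_mat_def block_mat_def map_matrix_def matrix_vector_mult_def sum_UNIV_Plus z_def
            mult_ac)
      also have "\<dots> = l * z $ p"
        by (simp add: matrix_vector_mult_diff_rdistrib e avg z_def Inl algebra_simps)
      finally show ?thesis .
    next
      case (Inr i)
      have "(map_matrix of_real (P_mat W V) *v z) $ p
          = of_real (((W - V) *v e) $ i) + (l - of_real w) * of_real (((mat 1 - avg_mat) *v e) $ i)"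
        unfolding Inr cplx[symmetric] sum_distrib_left
        by (simp add: P_mat_def block_mat_def map_matrix_def matrix_vector_mult_def sum_UNIV_Plus z_def
            mult_ac)
      \<comment> \<open>The quadratic is inserted as a block, so that rewriting it to zero leaves
        \<open>l * (l - w)\<close>.\<close>
      also have "\<dots> = (l - (l\<^sup>2 - (1 + of_real w) * l + of_real (\<theta> + (1 - \<theta>) * w)) + l\<^sup>2 - l * of_real w - l) * of_real (e $ i)"
        by (simp add: matrix_vector_mult_diff_rdistrib e Ve avg algebra_simps)
      also have "\<dots> = l * z $ p"
        unfolding l by (simp add: z_def Inr power2_eq_square algebra_simps)
      finally show ?thesis .
    qed
    then show ?thesis by (simp add: vec_eq_iff)
  qed
  moreover have "z \<noteq> 0"
  proof
    assume "z = 0"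
    then have "z $ Inl i = 0" for i by simp
    then have "e = 0" by (simp add: z_def vec_eq_iff)
    then show False using e by simp
  qed
  ultimately show ?thesis
    by (auto simp: spectrum_def)
qed

text \<open>In an orthonormal eigenbasis of \<open>W \<otimes>\<^sub>K mat 1\<close>, modes of
  eigenvalue 1 are killed by \<open>Q\<close>; on the others \<open>Q\<close> is invisible and
  \<open>mode_energy\<close> applies. Parseval's identity reassembles the modes without loss in the
  constants.\<close>

lemma disagreement_energy:
  fixes x u :: "nat \<Rightarrow> real ^ ('m::finite \<times> 'n::finite)" and W V :: "real ^ 'm ^ 'm"
  defines "Q \<equiv> \<lambda>z :: real ^ ('m \<times> 'n). (mat 1 - avg_mat \<otimes>\<^sub>K mat 1) *v z"
  assumes sym: "transpose W = W" and low: "- mat 1 \<prec>\<^sub>L W" and up: "W \<preceq>\<^sub>L mat 1"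
    and null: "null_space (mat 1 - W) = span {ones}"
    and \<theta>: "\<theta> \<le> 1 / 2" and V: "V = \<theta> *\<^sub>R mat 1 + (1 - \<theta>) *\<^sub>R W" and Vpos: "0 \<prec>\<^sub>L V"
    and r: "spectral_radius (P_mat W V) < 1"
    and rec: "\<And>k. x (Suc (Suc k)) = x (Suc k) + (W \<otimes>\<^sub>K mat 1) *v x (Suc k)
      - (V \<otimes>\<^sub>K mat 1) *v x k - u k"
  shows "energy (\<lambda>k. Q (x k)) \<lesssim>\<^sub>c
      (\<lambda>N. energy (\<lambda>k. Q (u k)) N / (1 - spectral_radius (P_mat W V)) ^ 4)"
    and "energy (\<lambda>k. Q (x (Suc k)) - Q (x k)) \<lesssim>\<^sub>c
      (\<lambda>N. 12 * (energy (\<lambda>k. Q (u k)) N / (1 - spectral_radius (P_mat W V))\<^sup>2))"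
proof -
  let ?r = "spectral_radius (P_mat W V)"
  let ?W = "\<lambda>z :: real ^ ('m \<times> 'n). (W \<otimes>\<^sub>K mat 1) *v z"
  let ?V = "\<lambda>z :: real ^ ('m \<times> 'n). (V \<otimes>\<^sub>K mat 1) *v z"
  let ?J = "\<lambda>z :: real ^ ('m \<times> 'n). (avg_mat \<otimes>\<^sub>K mat 1) *v z"
  note one = ones_fixed_if_null_space[OF null]
  obtain B where B: "finite B" "pairwise orthogonal B" "\<And>b. b \<in> B \<Longrightarrow> norm b = 1" "span B = UNIV"
    and eig: "\<And>b. b \<in> B \<Longrightarrow> \<exists>c. ?W b = c *\<^sub>R b"
    using selfadjoint_orthonormal_eigenbasis[OF matrix_vector_mul_linear inner_symmetric_kronecker[OF sym]]
    by blast
  have energy_B: "energy a = (\<lambda>N. \<Sum>b\<in>B. energy (\<lambda>k. b \<bullet> a k) N)"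
    for a :: "nat \<Rightarrow> real ^ ('m \<times> 'n)"
    unfolding energy_def by (subst sum.swap) (simp add: norm_power2_orthonormal_basis[OF B])
  have Q: "Q z = z - ?J z" for z
    by (simp add: Q_def matrix_vector_mult_diff_rdistrib)
  have J_sym: "b \<bullet> ?J z = ?J b \<bullet> z" for b z :: "real ^ ('m \<times> 'n)"
    using inner_symmetric_kronecker[OF transpose_avg_mat] by metis
  have JW: "?J (?W z) = ?J z" for z
    by (rule slice_eqI) (simp add: avg_mat_commute[OF sym one])
  have modes: "energy (\<lambda>k. b \<bullet> Q (x k)) \<lesssim>\<^sub>c (\<lambda>N. energy (\<lambda>k. b \<bullet> Q (u k)) N / (1 - ?r) ^ 4) \<and>
      energy (\<lambda>k. b \<bullet> (Q (x (Suc k)) - Q (x k))) \<lesssim>\<^sub>c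
      (\<lambda>N. 12 * (energy (\<lambda>k. b \<bullet> Q (u k)) N / (1 - ?r)\<^sup>2))"
    if "b \<in> B" for b
  proof -
    obtain w where w: "?W b = w *\<^sub>R b"
      using eig \<open>b \<in> B\<close> by blast
    have slice_w: "W *v slice b k = w *\<^sub>R slice b k" for k
      using arg_cong[OF w, of "\<lambda>z. slice z k"] by simp
    show ?thesis
    proof (cases "w = 1")
      case True
      have "?J b = b"
      proof (rule slice_eqI)
        fix k
        have "slice b k \<in> span {ones}"
          unfolding null[symmetric] null_space_def
          using slice_w[of k] True by (simp add: matrix_vector_mult_diff_rdistrib)
        then obtain t where "slice b k = t *\<^sub>R ones"
          by (auto simp: span_singleton)
        then show "slice (?J b) k = slice b k"
          by (simp add: matrix_vector_mult_scaleR)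
      qed
      then have "b \<bullet> Q z = 0" for z
        by (simp add: Q inner_diff_right J_sym)
      then show ?thesis
        by (auto simp: energy_def inner_diff_right intro!: le_upto_const_mono)
    next
      case False
      \<comment> \<open>Averaging absorbs \<open>W\<close>, so an eigenvector for any other
        eigenvalue has zero mean.\<close>
      have "w *\<^sub>R ?J b = ?J b"
        using JW[of b] by (simp add: w matrix_vector_mult_scaleR)
      then have "?J b = 0"
        using False by (metis scaleR_cancel_right scaleR_one)
      then have Qb: "b \<bullet> Q z = b \<bullet> z" for z
        by (simp add: Q inner_diff_right J_sym)
      have "b \<noteq> 0"
        using B(3)[OF \<open>b \<in> B\<close>] by auto
      then obtain k where "slice b k \<noteq> 0"
        using slice_eqI[of b 0] by auto
      \<comment> \<open>A nonzero slice of \<open>b\<close> is an eigenvector of \<open>W\<close>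
        itself, which links the mode to \<open>P_mat W V\<close> and to the definiteness
        hypotheses.\<close>
      define e where "e = slice b k"
      have e: "W *v e = w *\<^sub>R e" "e \<noteq> 0"
        using slice_w \<open>slice b k \<noteq> 0\<close> by (auto simp: e_def)
      define v where "v = \<theta> + (1 - \<theta>) * w"
      have Ve: "V *v z = v *\<^sub>R z" if "W *v z = w *\<^sub>R z" for z
        using that by (simp add: V v_def matrix_vector_mult_add_rdistrib
            scaleR_matrix_vector_assoc[symmetric] algebra_simps)
      have ee: "0 < e \<bullet> e" using e by simp
      have "0 < e \<bullet> ((W - - mat 1) *v e)"
        using low e by (auto simp: loewner_less_def pos_def_def)
      then have "0 < (w + 1) * (e \<bullet> e)"
        by (simp add: matrix_vector_mult_add_rdistrib e inner_add_right distrib_right)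
      then have w1: "- 1 < w"
        using ee by (simp add: zero_less_mult_iff)
      have "0 \<le> e \<bullet> ((mat 1 - W) *v e)"
        using up by (auto simp: loewner_le_def psd_def)
      then have "0 \<le> (1 - w) * (e \<bullet> e)"
        by (simp add: matrix_vector_mult_diff_rdistrib e inner_diff_right left_diff_distrib)
      then have w2: "w < 1"
        using ee False by (simp add: zero_le_mult_iff)
      have "0 < e \<bullet> ((V - 0) *v e)"
        using Vpos e by (auto simp: loewner_less_def pos_def_def)
      then have v0: "0 < v"
        using ee e by (simp add: Ve zero_less_mult_iff)
      have bW: "b \<bullet> ?W z = w * (b \<bullet> z)" for z
        using inner_symmetric_kronecker[OF sym, of b z] by (simp add: w)
      have symV: "transpose V = V"
        using Vpos by (simp add: loewner_less_def pos_def_def)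
      have "?V b = v *\<^sub>R b"
        by (rule slice_eqI) (simp add: Ve slice_w)
      then have bV: "b \<bullet> ?V z = v * (b \<bullet> z)" for z
        using inner_symmetric_kronecker[OF symV, of b z] by simp
      have rec_b: "b \<bullet> x (Suc (Suc k)) = (1 + w) * (b \<bullet> x (Suc k)) - v * (b \<bullet> x k) - b \<bullet> u k" for k
        unfolding rec by (simp add: inner_add_right inner_diff_right bW bV distrib_right)
      have root: "cmod l \<le> ?r" if "l\<^sup>2 - (1 + of_real w) * l + of_real v = 0" for l :: complex
        by (rule cmod_le_spectral_radius, rule root_in_spectrum_P_mat[OF sym one V e False])
          (use that v_def in simp)
      show ?thesis
        using mode_energy[where x = "\<lambda>k. b \<bullet> x k" and u = "\<lambda>k. b \<bullet> u k", OF rec_b w1 w2 \<theta> v_def v0 root r]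
        by (simp add: Qb inner_diff_right)
    qed
  qed
  have "energy (\<lambda>k. Q (x k)) \<lesssim>\<^sub>c (\<lambda>N. \<Sum>b\<in>B. energy (\<lambda>k. b \<bullet> Q (u k)) N / (1 - ?r) ^ 4)"
    unfolding energy_B[of "\<lambda>k. Q (x k)"] using B(1) modes by (intro le_upto_const_sum) auto
  then show "energy (\<lambda>k. Q (x k)) \<lesssim>\<^sub>c (\<lambda>N. energy (\<lambda>k. Q (u k)) N / (1 - ?r) ^ 4)"
    by (simp add: energy_B[of "\<lambda>k. Q (u k)"] sum_divide_distrib)
  have "energy (\<lambda>k. Q (x (Suc k)) - Q (x k)) \<lesssim>\<^sub>c
      (\<lambda>N. \<Sum>b\<in>B. 12 * (energy (\<lambda>k. b \<bullet> Q (u k)) N / (1 - ?r)\<^sup>2))"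
    unfolding energy_B[of "\<lambda>k. Q (x (Suc k)) - Q (x k)"]
    using B(1) modes by (intro le_upto_const_sum) auto
  then show "energy (\<lambda>k. Q (x (Suc k)) - Q (x k)) \<lesssim>\<^sub>c
      (\<lambda>N. 12 * (energy (\<lambda>k. Q (u k)) N / (1 - ?r)\<^sup>2))"
    by (simp add: energy_B[of "\<lambda>k. Q (u k)"] sum_divide_distrib sum_distrib_left)
qed

section \<open>Convergence\<close>

theorem mainTheorem3:
  fixes f :: "'m::finite \<Rightarrow> real ^ 'n::finite \<Rightarrow> real"
    and Lf :: "'m \<Rightarrow> real"
    and G :: "'m pair_pre_digraph"
    and W V :: "real ^ 'm ^ 'm"
    and \<theta> \<alpha> L :: real
    and x0 :: "real ^ ('m \<times> 'n)"
    and x :: "nat \<Rightarrow> real ^ ('m \<times> 'n)"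
  assumes "\<And>i y. f i differentiable (at y)"
    and "\<And>i y z. norm (grad (f i) y - grad (f i) z) \<le> Lf i * norm (y - z)"
    and "\<And>i. coercive (f i)"
    and "\<And>i. proper_fun (\<lambda>y. ereal (f i y))"
    and "pair_pseudo_graph G" and "pverts G = UNIV"
    and "Digraph_Component.connected (with_proj G)"
    and "\<And>i j. i \<noteq> j \<Longrightarrow> (i, j) \<notin> parcs G \<Longrightarrow> W $ i $ j = 0"
    and "transpose W = W"
    and "- mat 1 \<prec>\<^sub>L W" and "W \<preceq>\<^sub>L mat 1"
    and "null_space (mat 1 - W) = span {ones}"
    and "0 < \<theta>" and "\<theta> \<le> 1 / 2"
    and "V = \<theta> *\<^sub>R mat 1 + (1 - \<theta>) *\<^sub>R W"
    and "0 \<prec>\<^sub>L V"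
    and "L = Max (range Lf)"
    and "0 < \<alpha>"
    and "\<alpha> < (1 - (spectral_radius (P_mat W V))\<^sup>2) / (6 * L ^ 4 + 6 * L ^ 3 + 48 * L + 1)"
    and "x = extra f W V \<alpha> x0"
  shows "(\<lambda>k. (1 / real k) *
            (\<Sum>\<kappa><k. (norm ((mat 1 - avg_mat \<otimes>\<^sub>K mat 1) *v x \<kappa>))\<^sup>2)) \<in> O(\<lambda>k. 1 / real k)
       \<and> (\<lambda>k. (1 / real k) *
            (\<Sum>\<kappa><k. (norm ((avg_mat \<otimes>\<^sub>K mat 1) *v grad (F_sum f) (x \<kappa>)))\<^sup>2)) \<in> O(\<lambda>k. 1 / real k)"
proof -
  let ?J = "\<lambda>z :: real ^ ('m \<times> 'n). (avg_mat \<otimes>\<^sub>K mat 1) *v z"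
  let ?Q = "\<lambda>z :: real ^ ('m \<times> 'n). (mat 1 - avg_mat \<otimes>\<^sub>K mat 1) *v z"
  let ?W = "\<lambda>z :: real ^ ('m \<times> 'n). (W \<otimes>\<^sub>K mat 1) *v z"
  let ?V = "\<lambda>z :: real ^ ('m \<times> 'n). (V \<otimes>\<^sub>K mat 1) *v z"
  note diff = assms(1) and lip = assms(2) and sym = assms(9) and null = assms(12)
    and V = assms(15) and \<alpha> = \<open>0 < \<alpha>\<close>
  define F where "F = F_sum f"
  define g where "g k = grad F (x k)" for k
  define u where "u k = \<alpha> *\<^sub>R (g (Suc k) - g k)" for k
  note one = ones_fixed_if_null_space[OF null]
  have "Lf i \<le> L" for i
    by (simp add: assms(17))
  then have lip_L: "norm (grad (f i) y - grad (f i) z) \<le> L * norm (y - z)" for i y z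
    using lip[of i y z] by (meson mult_right_mono norm_ge_zero order_trans)
  have lip_F: "norm (grad F y - grad F z) \<le> L * norm (y - z)" for y z
    unfolding F_def by (rule grad_F_sum_lipschitz[OF diff lip_L])
  have L: "0 \<le> L"
    by (rule lipschitz_constant_nonneg[OF lip_F])
  define r p where "r = spectral_radius (P_mat W V)" and "p = 1 - r"
  define den where "den = 6 * L ^ 4 + 6 * L ^ 3 + 48 * L + 1"
  \<comment> \<open>This turns the step-size bound into \<open>48 * \<tau> < 1 - r\<^sup>2\<close>
    for the dimensionless step \<tau>.\<close>
  have den: "48 * L < den"
    using L by (simp add: den_def add_nonneg_pos)
  then have "0 < den" using L by linarith
  then have \<alpha>_den: "\<alpha> * den < 1 - r\<^sup>2"
    using assms(19) by (simp add: r_def den_def pos_less_divide_eq)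
  define \<tau> where "\<tau> = \<alpha> * L"
  have \<tau>0: "0 \<le> \<tau>" using \<alpha> L by (simp add: \<tau>_def)
  have "\<alpha> * (48 * L) < 1 - r\<^sup>2"
    using \<alpha>_den mult_strict_left_mono[OF den \<alpha>] by linarith
  then have \<tau>: "48 * \<tau> < 1 - r\<^sup>2"
    by (simp add: \<tau>_def)
  have \<tau>1: "\<tau> \<le> 1 / 48"
    using \<tau> zero_le_power2[of r] by linarith
  \<comment> \<open>Stability is no separate assumption: a positive admissible step size forces
    it.\<close>
  have "r\<^sup>2 < 1" using \<tau> \<tau>0 by linarith
  then have r1: "\<bar>r\<bar> < 1"
    by (simp add: abs_square_less_1)
  have p: "0 < p" using r1 by (simp add: p_def)
  have \<tau>p: "\<tau> \<le> p / 24"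
  proof -
    have "1 - r\<^sup>2 = p * (1 + r)"
      by (simp add: p_def power2_eq_square algebra_simps)
    also have "\<dots> \<le> p * 2"
      using p r1 by (intro mult_left_mono) auto
    finally show ?thesis using \<tau> by linarith
  qed

  have Q: "?Q z = z - ?J z" for z
    by (simp add: matrix_vector_mult_diff_rdistrib)
  have JJ: "?J (?J z) = ?J z" for z
    by (rule slice_eqI) simp
  have J_sym: "y \<bullet> ?J z = ?J y \<bullet> z" for y z
    using inner_symmetric_kronecker[OF transpose_avg_mat] by metis
  have pyth: "(norm z)\<^sup>2 = (norm (?Q z))\<^sup>2 + (norm (?J z))\<^sup>2" for z
  proof -
    have "?Q z \<bullet> ?J z = 0"
      by (simp add: Q J_sym matrix_vector_mult_diff_distrib JJ)
    then show ?thesis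
      using norm_add_Pythagorean[of "?Q z" "?J z"] by (simp add: orthogonal_def Q)
  qed
  have Q_le: "norm (?Q z) \<le> norm z" for z
    by (rule power2_le_imp_le) (simp_all add: pyth[of z])
  have JW: "?J (?W z) = ?J z" for z
    by (rule slice_eqI) (simp add: avg_mat_commute[OF sym one])
  have JV: "?J (?V z) = ?J z" for z
    by (rule slice_eqI)
      (simp add: V matrix_vector_mult_add_rdistrib matrix_vector_right_distrib matrix_vector_mult_scaleR
        scaleR_matrix_vector_assoc[symmetric] avg_mat_commute[OF sym one] flip: scaleR_left_distrib)
  have rec: "x (Suc (Suc k)) = x (Suc k) + ?W (x (Suc k)) - ?V (x k) - u k" for k
    by (simp add: \<open>x = extra f W V \<alpha> x0\<close> u_def g_def F_def)
  \<comment> \<open>After averaging, \<open>W\<close> and \<open>V\<close> disappear and the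
    recurrence equates consecutive defects of this identity; the first EXTRA step makes the initial
    defect zero.\<close>
  have mean: "?J (x (Suc k)) = ?J (x k) - \<alpha> *\<^sub>R ?J (g k)" for k
  proof (induction k)
    case 0
    have "x (Suc 0) = ?W (x 0) - \<alpha> *\<^sub>R g 0"
      by (simp add: \<open>x = extra f W V \<alpha> x0\<close> g_def F_def)
    then show ?case
      by (simp add: matrix_vector_mult_diff_distrib matrix_vector_mult_scaleR JW)
  next
    case (Suc k)
    then show ?case
      unfolding rec[of k] u_def
      by (simp add: matrix_vector_right_distrib matrix_vector_mult_diff_distrib
          matrix_vector_mult_scaleR JW JV scaleR_diff_right)
  qed

  \<comment> \<open>Energies of the disagreement, of its increments, of the averaged gradients, and
    of the forcing in the disagreement recurrence.\<close>
  define Y D G U where "Y = energy (\<lambda>k. ?Q (x k))" and "D = energy (\<lambda>k. ?Q (x (Suc k)) - ?Q (x k))"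
    and "G = energy (\<lambda>k. ?J (g k))" and "U = energy (\<lambda>k. ?Q (u k))"
  have Y: "Y \<lesssim>\<^sub>c (\<lambda>N. U N / p ^ 4)" and D: "D \<lesssim>\<^sub>c (\<lambda>N. 12 * (U N / p\<^sup>2))"
    using disagreement_energy[where x = x and u = u, OF sym assms(10,11) null assms(14) V assms(16) _ rec] r1
    by (simp_all add: Y_def D_def U_def p_def r_def)
  \<comment> \<open>The Lipschitz bound gives the full increment of \<open>x\<close>, which splits
    orthogonally into a disagreement part and, by \<open>mean\<close>, a multiple of the averaged
    gradient.\<close>
  have U_le: "U N \<le> \<tau>\<^sup>2 * (D N + \<alpha>\<^sup>2 * G N)" for N
  proof -
    have "(norm (?Q (u k)))\<^sup>2
        \<le> \<tau>\<^sup>2 * ((norm (?Q (x (Suc k)) - ?Q (x k)))\<^sup>2 + \<alpha>\<^sup>2 * (norm (?J (g k)))\<^sup>2)" for k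
    proof -
      have "norm (?Q (u k)) \<le> \<alpha> * norm (g (Suc k) - g k)"
        using Q_le[of "u k"] \<alpha> by (simp add: u_def)
      also have "\<dots> \<le> \<alpha> * (L * norm (x (Suc k) - x k))"
        using \<alpha> by (intro mult_left_mono) (auto simp: g_def lip_F)
      finally have "(norm (?Q (u k)))\<^sup>2 \<le> (\<tau> * norm (x (Suc k) - x k))\<^sup>2"
        by (intro power_mono) (auto simp: \<tau>_def)
      also have "\<dots> = \<tau>\<^sup>2 * ((norm (?Q (x (Suc k) - x k)))\<^sup>2 + (norm (?J (x (Suc k) - x k)))\<^sup>2)"
        by (simp add: power_mult_distrib pyth[symmetric])
      also have "?J (x (Suc k) - x k) = - \<alpha> *\<^sub>R ?J (g k)"
        by (simp add: matrix_vector_mult_diff_distrib mean)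
      finally show ?thesis
        by (simp add: matrix_vector_mult_diff_distrib power_mult_distrib)
    qed
    then show ?thesis
      unfolding U_def D_def G_def energy_def sum_distrib_left sum.distrib[symmetric]
      by (rule sum_mono)
  qed
  \<comment> \<open>The loop from \<open>D\<close> through \<open>U\<close> back to \<open>D\<close>
    has gain at most 12 / 24^2 = 1/48; absorbing it gives (1/48) / (1 - 1/48) = 1/47.\<close>
  have D_G: "D \<lesssim>\<^sub>c (\<lambda>N. 1 / 47 * (\<alpha>\<^sup>2 * G N))"
  proof -
    have step: "12 * (U N / p\<^sup>2) \<le> 1 / 48 * D N + 1 / 48 * (\<alpha>\<^sup>2 * G N)" for N
    proof -
      have "\<tau>\<^sup>2 \<le> (p / 24)\<^sup>2"
        using \<tau>p \<tau>0 by (rule power_mono)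
      then have "U N \<le> (p / 24)\<^sup>2 * (D N + \<alpha>\<^sup>2 * G N)"
        using U_le[of N] mult_right_mono[of "\<tau>\<^sup>2" "(p / 24)\<^sup>2" "D N + \<alpha>\<^sup>2 * G N"]
        by (simp add: D_def G_def energy_nonneg)
      then have le: "U N / p\<^sup>2 \<le> (D N + \<alpha>\<^sup>2 * G N) / 576"
        using p by (simp add: pos_divide_le_eq power_divide mult.commute)
      show ?thesis
        using mult_left_mono[OF le, of 12] by (simp add: add_divide_distrib mult.commute)
    qed
    have "D \<lesssim>\<^sub>c (\<lambda>N. 1 / 48 * D N + 1 / 48 * (\<alpha>\<^sup>2 * G N))"
      by (rule le_upto_const_trans[OF D le_upto_const_mono]) (rule step)
    from le_upto_const_absorb[OF this] show ?thesis
      by simp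
  qed
  have Y_G: "Y \<lesssim>\<^sub>c (\<lambda>N. \<tau>\<^sup>2 / p ^ 4 * (48 / 47 * (\<alpha>\<^sup>2 * G N)))"
  proof -
    note Y
    also have "(\<lambda>N. U N / p ^ 4) \<lesssim>\<^sub>c (\<lambda>N. \<tau>\<^sup>2 / p ^ 4 * (D N + \<alpha>\<^sup>2 * G N))"
    proof (rule le_upto_const_mono)
      show "U N / p ^ 4 \<le> \<tau>\<^sup>2 / p ^ 4 * (D N + \<alpha>\<^sup>2 * G N)" for N
        using divide_right_mono[OF U_le[of N], of "p ^ 4"] by simp
    qed
    also have "\<dots> \<lesssim>\<^sub>c (\<lambda>N. \<tau>\<^sup>2 / p ^ 4 * (1 / 47 * (\<alpha>\<^sup>2 * G N) + \<alpha>\<^sup>2 * G N))"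
      by (intro le_upto_const_cmult le_upto_const_add D_G) (auto intro: le_upto_const_mono)
    finally show ?thesis by (simp add: mult.commute)
  qed
  have L2Y: "(\<lambda>N. L\<^sup>2 * Y N) \<lesssim>\<^sub>c (\<lambda>N. 1 / 100 * G N)"
  proof -
    have "(\<lambda>N. L\<^sup>2 * Y N) \<lesssim>\<^sub>c (\<lambda>N. L\<^sup>2 * (\<tau>\<^sup>2 / p ^ 4 * (48 / 47 * (\<alpha>\<^sup>2 * G N))))"
      by (intro le_upto_const_cmult Y_G) simp
    also have "\<dots> \<lesssim>\<^sub>c (\<lambda>N. 1 / 100 * G N)"
    proof (rule le_upto_const_mono)
      fix N
      \<comment> \<open>The factors of \<open>L\<close> and \<alpha> combine into a second square of
        \<tau>, so the total gain is 48/47 times this fourth power.\<close>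
      have "(\<tau> / p) ^ 4 \<le> (1 / 24) ^ 4"
        using \<tau>p \<tau>0 p by (intro power_mono) (auto simp: divide_le_eq)
      also have "\<dots> \<le> 47 / 4800"
        by (simp add: power_divide)
      finally have "48 / 47 * (\<tau> / p) ^ 4 \<le> 1 / 100"
        by simp
      then have "48 / 47 * (\<tau> / p) ^ 4 * G N \<le> 1 / 100 * G N"
        by (rule mult_right_mono) (simp add: G_def energy_nonneg)
      also have "48 / 47 * (\<tau> / p) ^ 4 * G N = L\<^sup>2 * (\<tau>\<^sup>2 / p ^ 4 * (48 / 47 * (\<alpha>\<^sup>2 * G N)))"
        by (simp add: \<tau>_def power_divide power_mult_distrib power2_eq_square power4_eq_xxxx mult_ac)
      finally show "L\<^sup>2 * (\<tau>\<^sup>2 / p ^ 4 * (48 / 47 * (\<alpha>\<^sup>2 * G N))) \<le> 1 / 100 * G N" .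
    qed
    finally show ?thesis .
  qed

  obtain m where m: "\<And>z. m \<le> F z"
    using F_sum_bounded_below[of f, OF diff assms(3)] unfolding F_def[symmetric] by blast
  have GF: "GDERIV F z :> grad F z" for z
    unfolding F_def grad_eqI[OF GDERIV_F_sum[of f, OF diff]] by (rule GDERIV_F_sum[of f, OF diff])
  \<comment> \<open>The descent lemma along the mean iterates, multiplied by
    \<open>2 / \<alpha>\<close>. Replacing the gradient at the mean by \<open>g k\<close> costs the
    disagreement term.\<close>
  have descent: "(norm (?J (g k)))\<^sup>2 \<le> 2 / \<alpha> * (F (?J (x k)) - F (?J (x (Suc k))))
      + \<tau> * (norm (?J (g k)))\<^sup>2 + L\<^sup>2 * (norm (?Q (x k)))\<^sup>2" for k
  proof -
    let ?z = "?J (x k)" and ?h = "?J (g k)"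
    have "F (?J (x (Suc k))) \<le> F ?z + grad F ?z \<bullet> (?J (x (Suc k)) - ?z)
        + L / 2 * (norm (?J (x (Suc k)) - ?z))\<^sup>2"
      by (rule descent_lemma[OF GF lip_F])
    also have "?J (x (Suc k)) - ?z = - \<alpha> *\<^sub>R ?h"
      by (simp add: mean)
    finally have "F (?J (x (Suc k))) \<le> F ?z - \<alpha> * (grad F ?z \<bullet> ?h) + L / 2 * (\<alpha>\<^sup>2 * (norm ?h)\<^sup>2)"
      by (simp add: power_mult_distrib)
    \<comment> \<open>As \<open>?J\<close> is an orthogonal projection,
      \<open>g k \<bullet> ?h\<close> is the squared norm of \<open>?h\<close>; the gradient error
      is bounded by Cauchy-Schwarz and Young's inequality.\<close>
    moreover have "(norm ?h)\<^sup>2 - L\<^sup>2 * (norm (?Q (x k)))\<^sup>2 \<le> 2 * (grad F ?z \<bullet> ?h)"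
    proof -
      have "grad F ?z \<bullet> ?h = (grad F ?z - g k) \<bullet> ?h + (norm ?h)\<^sup>2"
        using J_sym[of "g k" "?J (g k)"] by (simp add: inner_diff_left JJ power2_norm_eq_inner)
      moreover have "- ((grad F ?z - g k) \<bullet> ?h) \<le> (L * norm (?Q (x k))) * norm ?h"
      proof -
        have "- ((grad F ?z - g k) \<bullet> ?h) = (g k - grad F ?z) \<bullet> ?h"
          by (simp add: inner_diff_left)
        also have "\<dots> \<le> norm (g k - grad F ?z) * norm ?h"
          by (rule norm_cauchy_schwarz)
        also have "\<dots> \<le> (L * norm (?Q (x k))) * norm ?h"
          using lip_F[of "x k" ?z] by (intro mult_right_mono) (auto simp: g_def Q)
        finally show ?thesis .
      qed
      moreover have "2 * (L * norm (?Q (x k))) * norm ?h \<le> (L * norm (?Q (x k)))\<^sup>2 + (norm ?h)\<^sup>2"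
        by (rule sum_squares_bound)
      ultimately show ?thesis
        by (simp add: power_mult_distrib)
    qed
    then have "\<alpha> / 2 * ((norm ?h)\<^sup>2 - L\<^sup>2 * (norm (?Q (x k)))\<^sup>2) \<le> \<alpha> / 2 * (2 * (grad F ?z \<bullet> ?h))"
      using \<alpha> by (intro mult_left_mono) auto
    ultimately have "\<alpha> / 2 * ((norm ?h)\<^sup>2 - L\<^sup>2 * (norm (?Q (x k)))\<^sup>2)
        \<le> F ?z - F (?J (x (Suc k))) + L / 2 * (\<alpha>\<^sup>2 * (norm ?h)\<^sup>2)"
      by simp
    then have "2 / \<alpha> * (\<alpha> / 2 * ((norm ?h)\<^sup>2 - L\<^sup>2 * (norm (?Q (x k)))\<^sup>2))
        \<le> 2 / \<alpha> * (F ?z - F (?J (x (Suc k))) + L / 2 * (\<alpha>\<^sup>2 * (norm ?h)\<^sup>2))"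
      using \<alpha> by (intro mult_left_mono) auto
    also have "2 / \<alpha> * (\<alpha> / 2 * ((norm ?h)\<^sup>2 - L\<^sup>2 * (norm (?Q (x k)))\<^sup>2))
        = (norm ?h)\<^sup>2 - L\<^sup>2 * (norm (?Q (x k)))\<^sup>2"
      using \<alpha> by simp
    also have "2 / \<alpha> * (F ?z - F (?J (x (Suc k))) + L / 2 * (\<alpha>\<^sup>2 * (norm ?h)\<^sup>2))
        = 2 / \<alpha> * (F ?z - F (?J (x (Suc k)))) + \<tau> * (norm ?h)\<^sup>2"
      using \<alpha> by (simp add: \<tau>_def power2_eq_square field_simps)
    finally show ?thesis by linarith
  qed
  \<comment> \<open>The objective values telescope, and the lower bound \<open>m\<close> makes their
    contribution a constant.\<close>
  have "G \<lesssim>\<^sub>c (\<lambda>N. \<tau> * G N + L\<^sup>2 * Y N)"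
  proof (rule le_upto_constI)
    fix N
    have "G N \<le> (\<Sum>k<N. 2 / \<alpha> * (F (?J (x k)) - F (?J (x (Suc k))))
        + \<tau> * (norm (?J (g k)))\<^sup>2 + L\<^sup>2 * (norm (?Q (x k)))\<^sup>2)"
      unfolding G_def energy_def by (rule sum_mono) (rule descent)
    also have "\<dots> = 2 / \<alpha> * (F (?J (x 0)) - F (?J (x N))) + \<tau> * G N + L\<^sup>2 * Y N"
      unfolding sum.distrib G_def Y_def energy_def sum_distrib_left[symmetric]
      by (simp only: sum_lessThan_telescope'[of "\<lambda>k. F (?J (x k))"])
    also have "\<dots> \<le> 2 / \<alpha> * (F (?J (x 0)) - m) + (\<tau> * G N + L\<^sup>2 * Y N)"
      using \<alpha> m[of "?J (x N)"] mult_left_mono[of "F (?J (x 0)) - F (?J (x N))" "F (?J (x 0)) - m" "2 / \<alpha>"]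
      by simp
    finally show "G N \<le> 2 / \<alpha> * (F (?J (x 0)) - m) + (\<tau> * G N + L\<^sup>2 * Y N)" .
  qed
  also have "\<dots> \<lesssim>\<^sub>c (\<lambda>N. 1 / 48 * G N + 1 / 100 * G N)"
    using \<tau>1 by (intro le_upto_const_add L2Y le_upto_const_mono mult_right_mono)
      (simp_all add: G_def energy_nonneg)
  \<comment> \<open>1/48 + 1/100 = 37/1200 < 1; the summand 0 matches the shape of
    \<open>le_upto_const_absorb\<close>.\<close>
  finally have "G \<lesssim>\<^sub>c (\<lambda>N. 37 / 1200 * G N + 0)"
    by (simp add: field_simps)
  from le_upto_const_absorb[OF this] have G0: "G \<lesssim>\<^sub>c (\<lambda>_. 0)"
    by simp
  have Y0: "Y \<lesssim>\<^sub>c (\<lambda>_. 0)"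
  proof -
    note Y_G
    also have "(\<lambda>N. \<tau>\<^sup>2 / p ^ 4 * (48 / 47 * (\<alpha>\<^sup>2 * G N)))
        \<lesssim>\<^sub>c (\<lambda>N. \<tau>\<^sup>2 / p ^ 4 * (48 / 47 * (\<alpha>\<^sup>2 * 0)))"
      by (intro le_upto_const_cmult G0) auto
    finally show ?thesis by simp
  qed
  have "(\<lambda>k. 1 / real k * energy a k) \<in> O(\<lambda>k. 1 / real k)" if bounded: "energy a \<lesssim>\<^sub>c (\<lambda>_. 0)"
    for a :: "nat \<Rightarrow> real ^ ('m \<times> 'n)"
  proof -
    obtain C where C: "\<forall>N. energy a N \<le> C"
      using bounded unfolding le_upto_const_def add_0_right ..
    \<comment> \<open>This holds for every \<open>k\<close>, including 0, where division by zero
      yields zero on both sides.\<close>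
    have "norm (1 / real k * energy a k) \<le> C * norm (1 / real k)" for k
      using mult_left_mono[OF C[rule_format, of k], of "1 / real k"] by (simp add: energy_nonneg abs_mult mult.commute)
    then show ?thesis
      by (intro bigoI always_eventually allI)
  qed
  from this[OF Y0[unfolded Y_def]] this[OF G0[unfolded G_def]] show ?thesis
    unfolding energy_def g_def F_def by (rule conjI)
qed

end
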